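(* Let $K$ be a field and let $\mathcal{D}$ be a weighted oriented graph with vertex set $\{x_1,\ldots,x_n\}$. If the underlying graph $G$ of $\mathcal{D}$ is a complete graph and $\mathcal{D}$ has no oriented cycles, then $I(\mathcal{D})$ is Cohen--Macaulay.
   Context: An oriented graph $\mathcal{D}$ is a finite simple graph $G$ (its underlying graph) together with an orientation of each of its edges; $V(\mathcal{D})$ is its vertex set and $E(\mathcal{D})$ is its set of arrows $(x_i,x_j)$ (from $x_i$ to $x_j$). It is weighted if it is endowed with a function $d\colon V(\mathcal{D})\to\mathbb{N}_+=\{1,2,\ldots\}$; write $d_i=d(x_i)$. Standing convention: if a vertex $x_i$ is a source (it has only arrows leaving it), then $d_i=1$. The edge ideal is $I(\mathcal{D})=(x_ix_j^{d_j}\mid (x_i,x_j)\in E(\mathcal{D}))\subset R=K[x_1,\ldots,x_n]$. An ideal $J\subset R$ is called Cohen--Macaulay if $R/J$ is a Cohen--Macaulay ring. *)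

theory Defs
  imports "HOL-Algebra.Algebra" "HOL-Algebra.Algebraic_Closure_Type"
    "HOL-Library.Poly_Mapping" "HOL-Library.Extended_Nat"
begin

definition loc_rel :: "('a, 'b) ring_scheme \<Rightarrow> 'a set \<Rightarrow> (('a \<times> 'a) \<times> ('a \<times> 'a)) set" where
  "loc_rel A S = {((a, s), (b, t)). a \<in> carrier A \<and> b \<in> carrier A \<and> s \<in> S \<and> t \<in> S \<and>
     (\<exists>u\<in>S. u \<otimes>\<^bsub>A\<^esub> (a \<otimes>\<^bsub>A\<^esub> t) = u \<otimes>\<^bsub>A\<^esub> (b \<otimes>\<^bsub>A\<^esub> s))}"

definition loc_frac :: "('a, 'b) ring_scheme \<Rightarrow> 'a set \<Rightarrow> 'a \<Rightarrow> 'a \<Rightarrow> ('a \<times> 'a) set" where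
  "loc_frac A S a s = loc_rel A S `` {(a, s)}"

text \<open>The operations take the union over all representatives; for multiplicatively closed \<open>S\<close> all
  the sets united are the same fraction.\<close>

definition localization :: "('a, 'b) ring_scheme \<Rightarrow> 'a set \<Rightarrow> ('a \<times> 'a) set ring" where
  "localization A S =
    \<lparr>carrier = {loc_frac A S a s | a s. a \<in> carrier A \<and> s \<in> S},
     monoid.mult = (\<lambda>u v. \<Union>(a, s)\<in>u. \<Union>(b, t)\<in>v. loc_frac A S (a \<otimes>\<^bsub>A\<^esub> b) (s \<otimes>\<^bsub>A\<^esub> t)),
     one = loc_frac A S \<one>\<^bsub>A\<^esub> \<one>\<^bsub>A\<^esub>,
     ring.zero = loc_frac A S \<zero>\<^bsub>A\<^esub> \<one>\<^bsub>A\<^esub>,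
     add = (\<lambda>u v. \<Union>(a, s)\<in>u. \<Union>(b, t)\<in>v.
        loc_frac A S (a \<otimes>\<^bsub>A\<^esub> t \<oplus>\<^bsub>A\<^esub> b \<otimes>\<^bsub>A\<^esub> s) (s \<otimes>\<^bsub>A\<^esub> t))\<rparr>"

definition krull_dim :: "('a, 'b) ring_scheme \<Rightarrow> enat" where
  "krull_dim A = Sup {enat k | k. \<exists>P. (\<forall>i\<le>k. primeideal (P i) A) \<and> (\<forall>i<k. P i \<subset> P (Suc i))}"

text \<open>Multiplication by each entry is injective modulo the ideal generated by the earlier entries.\<close>

definition regular_sequence :: "('a, 'b) ring_scheme \<Rightarrow> 'a list \<Rightarrow> bool" where
  "regular_sequence A xs \<longleftrightarrow> set xs \<subseteq> carrier A \<and>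
     (\<forall>i<length xs. \<forall>a\<in>carrier A.
        xs ! i \<otimes>\<^bsub>A\<^esub> a \<in> Idl\<^bsub>A\<^esub> (set (take i xs)) \<longrightarrow> a \<in> Idl\<^bsub>A\<^esub> (set (take i xs))) \<and>
     Idl\<^bsub>A\<^esub> (set xs) \<noteq> carrier A"

definition depth_on :: "'a set \<Rightarrow> ('a, 'b) ring_scheme \<Rightarrow> enat" where
  "depth_on I A = Sup {enat (length xs) | xs. regular_sequence A xs \<and> set xs \<subseteq> I}"

definition cohen_macaulay_local_ring :: "('a, 'b) ring_scheme \<Rightarrow> bool" where
  "cohen_macaulay_local_ring A \<longleftrightarrow> cring A \<and> noetherian_ring A \<and>
     (\<exists>M. maximalideal M A \<and> (\<forall>M'. maximalideal M' A \<longrightarrow> M' = M) \<and> depth_on M A = krull_dim A)"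

definition cohen_macaulay_ring :: "('a, 'b) ring_scheme \<Rightarrow> bool" where
  "cohen_macaulay_ring A \<longleftrightarrow> cring A \<and> noetherian_ring A \<and>
     (\<forall>M. maximalideal M A \<longrightarrow> cohen_macaulay_local_ring (localization A (carrier A - M)))"

definition cohen_macaulay_ideal :: "'a set \<Rightarrow> ('a, 'b) ring_scheme \<Rightarrow> bool" where
  "cohen_macaulay_ideal J A \<longleftrightarrow> ideal J A \<and> cohen_macaulay_ring (A Quot J)"

text \<open>The vertex set is a finite type, and an oriented graph on it is its set of arrows. Asymmetry
  says that there are no loops and that every edge carries only one orientation.\<close>

definition oriented_graph :: "('v::finite \<times> 'v) set \<Rightarrow> bool" where
  "oriented_graph E \<longleftrightarrow> asym E"

definition underlying_edges :: "('v \<times> 'v) set \<Rightarrow> 'v set set" where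
  "underlying_edges E = {{x, y} | x y. (x, y) \<in> E}"

definition complete_graph :: "'v set set \<Rightarrow> bool" where
  "complete_graph G \<longleftrightarrow> G = {{x, y} | x y. x \<noteq> y}"

definition oriented_cycle :: "('v \<times> 'v) set \<Rightarrow> 'v list \<Rightarrow> bool" where
  "oriented_cycle E c \<longleftrightarrow> length c \<ge> 3 \<and> distinct c \<and>
     (\<forall>i<length c. (c ! i, c ! (Suc i mod length c)) \<in> E)"

text \<open>An isolated vertex is not a source here; its weight does not enter the edge ideal.\<close>

definition source :: "('v \<times> 'v) set \<Rightarrow> 'v \<Rightarrow> bool" where
  "source E x \<longleftrightarrow> (\<exists>y. (x, y) \<in> E) \<and> (\<forall>y. (y, x) \<notin> E)"

definition weighted_oriented_graph :: "('v::finite \<times> 'v) set \<Rightarrow> ('v \<Rightarrow> nat) \<Rightarrow> bool" where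
  "weighted_oriented_graph E d \<longleftrightarrow>
     oriented_graph E \<and> (\<forall>x. d x \<ge> 1) \<and> (\<forall>x. source E x \<longrightarrow> d x = 1)"

text \<open>Polynomials over \<open>'k\<close> in variables indexed by \<open>'v\<close>: finitely supported functions from
  exponent vectors to coefficients, with the convolution product.\<close>

type_synonym ('v, 'k) mpoly = "('v \<Rightarrow>\<^sub>0 nat) \<Rightarrow>\<^sub>0 'k"

definition polynomial_ring :: "('v::finite, 'k::field) mpoly ring" where
  "polynomial_ring = ring_of_type_algebra"

definition indet :: "'v \<Rightarrow> ('v, 'k::field) mpoly" where
  "indet x = Poly_Mapping.single (Poly_Mapping.single x 1) 1"

definition edge_ideal :: "('v::finite \<times> 'v) set \<Rightarrow> ('v \<Rightarrow> nat) \<Rightarrow> ('v, 'k::field) mpoly set" where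
  "edge_ideal E d = Idl\<^bsub>polynomial_ring\<^esub> {indet x * indet y ^ d y | x y. (x, y) \<in> E}"

end

theory Submission
  imports Defs
begin

text \<open>
  Let \<open>I\<close> be the edge ideal, \<open>R\<close> the polynomial ring and, for a vertex \<open>i\<close>, let \<open>P\<^sub>i\<close> be the prime
  generated by all variables but \<open>x\<^sub>i\<close>, the ideal of the \<open>i\<close>-th coordinate axis. As every two vertices
  are joined by an arrow, a prime above \<open>I\<close> contains one of every two variables, hence some \<open>P\<^sub>i\<close>
  (\<open>prime_above_edge_ideal\<close>); and \<open>R / P\<^sub>i = K[t]\<close>, so that all primes strictly above \<open>P\<^sub>i\<close> are maximal
  (\<open>maximal_above_axis_ideal\<close>). Thus \<open>R / I\<close> has dimension at most one, and it remains to see that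
  it has no embedded primes.

  That is where acyclicity enters. A tournament without oriented cycles is a strict linear order,
  and a monomial \<open>m \<noteq> 1\<close> outside \<open>I\<close>, with first vertex \<open>i\<close> in its support, is divisible by no \<open>x\<^sub>j\<close> with
  \<open>j\<close> before \<open>i\<close> and by no \<open>x\<^sub>j ^ d\<^sub>j\<close> with \<open>j\<close> after \<open>i\<close>. These powers generate the \<open>P\<^sub>i\<close>-primary component
  \<open>Q\<^sub>i\<close> of \<open>I\<close>, so \<open>I\<close> is the intersection of the \<open>Q\<^sub>i\<close>, and a polynomial outside all \<open>P\<^sub>i\<close> is a
  nonzerodivisor modulo \<open>I\<close> (\<open>edge_ideal_nonzerodivisor\<close>). Every maximal ideal \<open>M\<close> above \<open>I\<close> contains
  such a polynomial: if \<open>M\<close> contains \<open>P\<^sub>i\<close> and \<open>g\<close> lies in \<open>M\<close> but not in \<open>P\<^sub>i\<close>, one is \<open>g x\<^sub>i\<close> plus the sum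
  of the other variables (\<open>mem_all_but_axis_ideals\<close>).

  The rest is commutative algebra of one-dimensional rings
  (\<open>cohen_macaulay_ideal_of_dimension_one\<close>). If a nonzerodivisor modulo \<open>I\<close> lies in \<open>M\<close>, then \<open>M\<close> is not
  a minimal prime over \<open>I\<close> and the localization at \<open>M\<close> has depth at least one. In it, a
  regular element of the maximal ideal lies in no other prime, so all elements of the maximal ideal
  are nilpotent modulo that element and no regular sequence has length two. Hence depth and dimension are both
  one. Noetherianity follows from a theorem of Cohen: it suffices to find finite generators for the
  primes above \<open>I\<close>, and these are visible from \<open>K[t]\<close> being a principal ideal domain.
\<close>

section \<open>Ideals of a commutative ring type\<close>

lemma ring_of_type_algebra_simps [simp]:
  "carrier ring_of_type_algebra = UNIV"
  "a \<otimes>\<^bsub>ring_of_type_algebra\<^esub> b = a * b"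
  "a \<oplus>\<^bsub>ring_of_type_algebra\<^esub> b = a + b"
  "\<one>\<^bsub>ring_of_type_algebra\<^esub> = 1"
  "\<zero>\<^bsub>ring_of_type_algebra\<^esub> = 0"
  by (simp_all add: ring_of_type_algebra_def)

abbreviation type_ideal :: "'a::comm_ring_1 set \<Rightarrow> bool" where
  "type_ideal J \<equiv> ideal J ring_of_type_algebra"

abbreviation type_prime :: "'a::comm_ring_1 set \<Rightarrow> bool" where
  "type_prime P \<equiv> primeideal P ring_of_type_algebra"

abbreviation type_maximal :: "'a::comm_ring_1 set \<Rightarrow> bool" where
  "type_maximal M \<equiv> maximalideal M ring_of_type_algebra"

abbreviation generated :: "'a::comm_ring_1 set \<Rightarrow> 'a set" where
  "generated T \<equiv> genideal ring_of_type_algebra T"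

lemma (in cring) ideal_by_closure:
  assumes "J \<subseteq> carrier R" "\<zero> \<in> J"
    and add: "\<And>a b. a \<in> J \<Longrightarrow> b \<in> J \<Longrightarrow> a \<oplus> b \<in> J"
    and mult: "\<And>r a. r \<in> carrier R \<Longrightarrow> a \<in> J \<Longrightarrow> r \<otimes> a \<in> J"
  shows "ideal J R"
proof (rule idealI[OF ring_axioms])
  have "inv\<^bsub>add_monoid R\<^esub> a \<in> J" if a: "a \<in> J" for a
  proof -
    have "\<ominus> \<one> \<otimes> a = \<ominus> a" using a assms(1) by (auto simp: l_minus)
    then show ?thesis using mult[of "\<ominus> \<one>", OF _ a] by (simp add: a_inv_def)
  qed
  then show "subgroup J (add_monoid R)"
    using assms by (intro subgroup.intro) auto
  show "x \<otimes> a \<in> J" "a \<otimes> x \<in> J" if "a \<in> J" "x \<in> carrier R" for a x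
    using mult[OF that(2,1)] that assms(1) m_comm[of a x] by auto
qed

lemma type_ideal_iff:
  fixes J :: "'a::comm_ring_1 set"
  shows "type_ideal J \<longleftrightarrow> 0 \<in> J \<and> (\<forall>a\<in>J. \<forall>b\<in>J. a + b \<in> J) \<and> (\<forall>r. \<forall>a\<in>J. r * a \<in> J)"
proof
  assume "type_ideal J"
  then interpret ideal J ring_of_type_algebra .
  show "0 \<in> J \<and> (\<forall>a\<in>J. \<forall>b\<in>J. a + b \<in> J) \<and> (\<forall>r. \<forall>a\<in>J. r * a \<in> J)"
    using additive_subgroup.zero_closed[OF is_additive_subgroup]
      additive_subgroup.a_closed[OF is_additive_subgroup] I_l_closed by auto
next
  interpret cring "ring_of_type_algebra :: 'a ring" ..
  assume "0 \<in> J \<and> (\<forall>a\<in>J. \<forall>b\<in>J. a + b \<in> J) \<and> (\<forall>r. \<forall>a\<in>J. r * a \<in> J)"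
  then show "type_ideal J" by (intro ideal_by_closure) auto
qed

lemma type_idealD:
  assumes "type_ideal J"
  shows "0 \<in> J" "a \<in> J \<Longrightarrow> b \<in> J \<Longrightarrow> a + b \<in> J" "a \<in> J \<Longrightarrow> r * a \<in> J" "a \<in> J \<Longrightarrow> a * r \<in> J"
    "a \<in> J \<Longrightarrow> - a \<in> J" "a \<in> J \<Longrightarrow> b \<in> J \<Longrightarrow> a - b \<in> J"
proof -
  have *: "0 \<in> J" "\<And>a b. a \<in> J \<Longrightarrow> b \<in> J \<Longrightarrow> a + b \<in> J" "\<And>a r. a \<in> J \<Longrightarrow> r * a \<in> J"
    using assms by (auto simp: type_ideal_iff)
  have neg: "- a \<in> J" if "a \<in> J" for a
    using *(3)[OF that, of "-1"] by simp
  show "0 \<in> J" "a \<in> J \<Longrightarrow> b \<in> J \<Longrightarrow> a + b \<in> J" "a \<in> J \<Longrightarrow> r * a \<in> J" "a \<in> J \<Longrightarrow> a * r \<in> J"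
    "a \<in> J \<Longrightarrow> - a \<in> J" "a \<in> J \<Longrightarrow> b \<in> J \<Longrightarrow> a - b \<in> J"
    using * neg *(2)[OF _ neg] by (auto simp: mult.commute)
qed

lemma type_ideal_eq_UNIV_iff: "type_ideal J \<Longrightarrow> J = UNIV \<longleftrightarrow> 1 \<in> J"
  using type_idealD(3)[of J 1] by auto

lemma type_prime_iff:
  fixes P :: "'a::comm_ring_1 set"
  shows "type_prime P \<longleftrightarrow> type_ideal P \<and> 1 \<notin> P \<and> (\<forall>a b. a * b \<in> P \<longrightarrow> a \<in> P \<or> b \<in> P)"
proof
  assume "type_prime P"
  then interpret primeideal P ring_of_type_algebra .
  show "type_ideal P \<and> 1 \<notin> P \<and> (\<forall>a b. a * b \<in> P \<longrightarrow> a \<in> P \<or> b \<in> P)"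
    using I_notcarr I_prime is_ideal type_ideal_eq_UNIV_iff[OF is_ideal] by auto
next
  assume "type_ideal P \<and> 1 \<notin> P \<and> (\<forall>a b. a * b \<in> P \<longrightarrow> a \<in> P \<or> b \<in> P)"
  then show "type_prime P"
    by (intro primeidealI cring_from_type_algebra) auto
qed

lemma type_maximalD:
  assumes "type_maximal M"
  shows "type_ideal M" "type_prime M" "1 \<notin> M"
    "\<And>J. type_ideal J \<Longrightarrow> M \<subseteq> J \<Longrightarrow> 1 \<notin> J \<Longrightarrow> J = M"
proof -
  show P: "type_prime M"
    by (rule cring.maximalideal_prime[OF cring_from_type_algebra assms])
  then show "1 \<notin> M" by (simp add: type_prime_iff)
  interpret maximalideal M ring_of_type_algebra by fact
  show "type_ideal M" by (rule is_ideal)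
  show "\<And>J. type_ideal J \<Longrightarrow> M \<subseteq> J \<Longrightarrow> 1 \<notin> J \<Longrightarrow> J = M"
    using I_maximal by auto
qed

lemma type_maximalI:
  assumes "type_ideal M" "1 \<notin> M" "\<And>J. type_ideal J \<Longrightarrow> M \<subset> J \<Longrightarrow> 1 \<in> J"
  shows "type_maximal M"
  using assms by (intro maximalidealI) (auto simp: type_ideal_eq_UNIV_iff)

lemma generated_ideal: "type_ideal (generated T)"
  and generated_superset: "T \<subseteq> generated T"
  and generated_minimal: "type_ideal J \<Longrightarrow> T \<subseteq> J \<Longrightarrow> generated T \<subseteq> J"
proof -
  interpret cring "ring_of_type_algebra :: 'a ring" ..
  show "type_ideal (generated T)" "T \<subseteq> generated T"
    "type_ideal J \<Longrightarrow> T \<subseteq> J \<Longrightarrow> generated T \<subseteq> J"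
    by (simp_all add: genideal_ideal genideal_minimal genideal_self)
qed

text \<open>The ideal generated by \<open>J\<close> and \<open>a\<close>, for an ideal \<open>J\<close>; the explicit form exposes the cofactor of \<open>a\<close>.\<close>

definition adjoin :: "'a::comm_ring_1 set \<Rightarrow> 'a \<Rightarrow> 'a set" where
  "adjoin J a = {j + r * a | j r. j \<in> J}"

lemma adjoin_ideal: assumes "type_ideal J" shows "type_ideal (adjoin J a)"
  unfolding type_ideal_iff
proof (intro conjI ballI allI)
  note J = type_idealD[OF assms]
  show "0 \<in> adjoin J a"
    unfolding adjoin_def using J(1) by (auto intro!: exI[of _ 0])
  show "x + y \<in> adjoin J a" if xy: "x \<in> adjoin J a" "y \<in> adjoin J a" for x y
  proof -
    obtain j r k t where "x = j + r * a" "y = k + t * a" "j \<in> J" "k \<in> J"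
      using xy unfolding adjoin_def by auto
    then have "x + y = (j + k) + (r + t) * a" "j + k \<in> J"
      using J(2) by (auto simp: algebra_simps)
    then show ?thesis unfolding adjoin_def by blast
  qed
  show "c * x \<in> adjoin J a" if x: "x \<in> adjoin J a" for c x
  proof -
    obtain j r where "x = j + r * a" "j \<in> J"
      using x unfolding adjoin_def by auto
    then have "c * x = c * j + (c * r) * a" "c * j \<in> J"
      by (simp_all add: J(3) algebra_simps)
    then show ?thesis unfolding adjoin_def by blast
  qed
qed

lemma adjoin_superset: "J \<subseteq> adjoin J a"
proof
  fix x assume "x \<in> J"
  moreover have "x = x + 0 * a" by simp
  ultimately show "x \<in> adjoin J a" unfolding adjoin_def by blast
qed

lemma adjoin_mem: assumes "type_ideal J" shows "a \<in> adjoin J a"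
proof -
  have "a = 0 + 1 * a" by simp
  then show ?thesis unfolding adjoin_def using type_idealD(1)[OF assms] by blast
qed

lemma adjoin_strict: "type_ideal J \<Longrightarrow> a \<notin> J \<Longrightarrow> J \<subset> adjoin J a"
  using adjoin_superset adjoin_mem by fast

lemma Union_chain_ideal:
  assumes "C \<noteq> {}" "subset.chain A C" "\<And>Q. Q \<in> A \<Longrightarrow> type_ideal Q"
  shows "type_ideal (\<Union>C)"
  unfolding type_ideal_iff
proof (intro conjI ballI allI)
  have id: "type_ideal Q" if "Q \<in> C" for Q
    using assms(2,3) that by (auto simp: subset.chain_def)
  show "0 \<in> \<Union>C" using assms(1) id type_idealD(1) by blast
  show "r * x \<in> \<Union>C" if "x \<in> \<Union>C" for r x
    using that id type_idealD(3) by blast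
  show "x + y \<in> \<Union>C" if xy: "x \<in> \<Union>C" "y \<in> \<Union>C" for x y
  proof -
    obtain Q where "Q \<in> C" "x \<in> Q" "y \<in> Q"
      using xy assms(2) unfolding subset.chain_def by blast
    then show ?thesis using id type_idealD(2) by blast
  qed
qed

text \<open>Krull: an ideal that is maximal among those containing \<open>J\<close> and missing \<open>S\<close> is prime, because if
  neither \<open>a\<close> nor \<open>b\<close> belongs to it, then adjoining either one produces an element of \<open>S\<close>, and the
  product of the two elements would lie in the ideal if \<open>a * b\<close> did.\<close>

lemma prime_disjoint_from_multiplicative_set:
  assumes J: "type_ideal J" and one: "1 \<in> S"
    and mult: "\<And>s t. s \<in> S \<Longrightarrow> t \<in> S \<Longrightarrow> s * t \<in> S"
    and disj: "J \<inter> S = {}"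
  obtains P where "type_prime P" "J \<subseteq> P" "P \<inter> S = {}"
proof -
  define A where "A = {Q. type_ideal Q \<and> J \<subseteq> Q \<and> Q \<inter> S = {}}"
  have "\<exists>P\<in>A. \<forall>Y\<in>A. P \<subseteq> Y \<longrightarrow> Y = P"
  proof (rule subset_Zorn_nonempty)
    show "A \<noteq> {}" using J disj by (auto simp: A_def)
    fix C assume C: "C \<noteq> {}" "subset.chain A C"
    then have "type_ideal (\<Union>C)"
      by (rule Union_chain_ideal) (auto simp: A_def)
    moreover have "J \<subseteq> \<Union>C" "\<Union>C \<inter> S = {}"
      using C unfolding A_def subset.chain_def by blast+
    ultimately show "\<Union>C \<in> A" by (simp add: A_def)
  qed
  then obtain P where P: "type_ideal P" "J \<subseteq> P" "P \<inter> S = {}"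
    and max: "\<And>Y. Y \<in> A \<Longrightarrow> P \<subseteq> Y \<Longrightarrow> Y = P"
    by (auto simp: A_def)
  have meets: "\<exists>p r. p \<in> P \<and> p + r * a \<in> S" if "a \<notin> P" for a
  proof (rule ccontr)
    assume "\<not> ?thesis"
    then have "adjoin P a \<in> A"
      using adjoin_ideal[OF P(1)] adjoin_superset[of P a] P(2)
      unfolding A_def adjoin_def by blast
    then show False
      using max adjoin_strict[OF P(1) that] by blast
  qed
  have "a \<in> P \<or> b \<in> P" if ab: "a * b \<in> P" for a b
  proof (rule ccontr)
    assume "\<not> ?thesis"
    then obtain p r q t where pq: "p \<in> P" "p + r * a \<in> S" "q \<in> P" "q + t * b \<in> S"
      using meets by meson
    have "(p + r * a) * (q + t * b) = p * (q + t * b) + (r * a) * q + (r * t) * (a * b)"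
      by (simp add: algebra_simps)
    also have "\<dots> \<in> P"
      by (intro type_idealD(2)[OF P(1)] type_idealD(4)[OF P(1) pq(1)]
          type_idealD(3)[OF P(1) pq(3)] type_idealD(3)[OF P(1) ab])
    finally show False using mult pq P(3) by blast
  qed
  moreover have "1 \<notin> P" using one P(3) by blast
  ultimately have "type_prime P" using P(1) by (simp add: type_prime_iff)
  then show ?thesis using that P by blast
qed

text \<open>The products \<open>s * f ^ k\<close> with \<open>s \<notin> P\<close> form a multiplicative set, and a prime that misses it
  lies below \<open>P\<close> (take \<open>k = 0\<close>) and avoids \<open>f\<close> (take \<open>s = 1\<close>, \<open>k = 1\<close>). All arguments below about nilpotents
  and zero divisors in a localization go through this lemma.\<close>

lemma prime_between_avoiding_element:
  assumes J: "type_ideal J" and P: "type_prime P"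
    and avoid: "\<And>s k. s \<notin> P \<Longrightarrow> s * f ^ k \<notin> J"
  obtains P' where "type_prime P'" "J \<subseteq> P'" "P' \<subseteq> P" "f \<notin> P'"
proof -
  define S where "S = {s * f ^ k | s k. s \<notin> P}"
  have S: "s * f ^ k \<in> S" if "s \<notin> P" for s k using that unfolding S_def by blast
  have P': "1 \<notin> P" "\<And>a b. a * b \<in> P \<Longrightarrow> a \<in> P \<or> b \<in> P"
    using P by (auto simp: type_prime_iff)
  have mult: "x * y \<in> S" if xy: "x \<in> S" "y \<in> S" for x y
  proof -
    obtain s k t l where "x = s * f ^ k" "y = t * f ^ l" "s \<notin> P" "t \<notin> P"
      using xy unfolding S_def by blast
    then have "x * y = (s * t) * f ^ (k + l)" "s * t \<notin> P"
      using P'(2) by (auto simp: power_add ac_simps)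
    then show ?thesis using S by metis
  qed
  have one: "1 \<in> S" using S[OF P'(1), of 0] by simp
  have disj: "J \<inter> S = {}" using avoid unfolding S_def by blast
  obtain P' where Q: "type_prime P'" "J \<subseteq> P'" "P' \<inter> S = {}"
    using prime_disjoint_from_multiplicative_set[OF J one mult disj] by metis
  have "P' \<subseteq> P"
  proof
    fix x assume "x \<in> P'"
    then show "x \<in> P" using S[of x 0] Q(3) by auto
  qed
  moreover have "f \<notin> P'" using S[OF P'(1), of 1] Q(3) by auto
  ultimately show ?thesis using that Q by blast
qed

text \<open>Cohen: an ideal \<open>P\<close> that is maximal among those above \<open>I\<close> without a finite set of generators is
  prime. Indeed, if \<open>a * b \<in> P\<close> with \<open>a\<close> and \<open>b\<close> outside, then \<open>P + (a)\<close> and the colon ideal \<open>(P : a)\<close>, which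
  contains \<open>b\<close>, are strictly larger and so finitely generated. The summands in \<open>P\<close> of generators
  of \<open>P + (a)\<close>, together with \<open>a\<close> times the generators of \<open>(P : a)\<close>, then generate \<open>P\<close>.\<close>

lemma finitely_generated_if_primes_finitely_generated:
  assumes primes: "\<And>P. type_prime P \<Longrightarrow> I \<subseteq> P \<Longrightarrow> \<exists>T. finite T \<and> P = generated T"
    and J: "type_ideal J" "I \<subseteq> J"
  shows "\<exists>T. finite T \<and> J = generated T"
proof (rule ccontr)
  assume notfg: "\<not> ?thesis"
  define A where "A = {Q. type_ideal Q \<and> I \<subseteq> Q \<and> \<not> (\<exists>T. finite T \<and> Q = generated T)}"
  have "\<exists>P\<in>A. \<forall>Y\<in>A. P \<subseteq> Y \<longrightarrow> Y = P"
  proof (rule subset_Zorn_nonempty)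
    show "A \<noteq> {}" using J notfg by (auto simp: A_def)
    fix C assume C: "C \<noteq> {}" "subset.chain A C"
    have id: "type_ideal (\<Union>C)"
      using C by (rule Union_chain_ideal) (auto simp: A_def)
    have "\<not> (\<exists>T. finite T \<and> \<Union>C = generated T)"
    proof
      assume "\<exists>T. finite T \<and> \<Union>C = generated T"
      then obtain T where T: "finite T" "\<Union>C = generated T" by blast
      have "T \<subseteq> \<Union>C" using T generated_superset by auto
      then obtain Q where Q: "Q \<in> C" "T \<subseteq> Q"
        using finite_subset_Union_chain[OF T(1) _ C] by blast
      then have QA: "Q \<in> A" using C by (auto simp: subset.chain_def)
      then have "generated T \<subseteq> Q" using generated_minimal Q by (auto simp: A_def)
      then have "Q = generated T" using T Q by blast
      then show False using QA T by (auto simp: A_def)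
    qed
    moreover have "I \<subseteq> \<Union>C" using C unfolding A_def subset.chain_def by blast
    ultimately show "\<Union>C \<in> A" using id by (simp add: A_def)
  qed
  then obtain P where P: "type_ideal P" "I \<subseteq> P" "\<not> (\<exists>T. finite T \<and> P = generated T)"
    and max: "\<And>Y. Y \<in> A \<Longrightarrow> P \<subseteq> Y \<Longrightarrow> Y = P"
    by (auto simp: A_def)
  have larger: "\<exists>T. finite T \<and> Y = generated T" if "type_ideal Y" "P \<subset> Y" for Y
    using max[of Y] that P(2) unfolding A_def by blast
  have "a \<in> P \<or> b \<in> P" if ab: "a * b \<in> P" for a b
  proof (rule ccontr)
    assume nab: "\<not> ?thesis"
    obtain T where T: "finite T" "adjoin P a = generated T"
      using larger adjoin_ideal adjoin_strict P(1) nab by metis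
    have "\<forall>t\<in>T. \<exists>p. p \<in> P \<and> (\<exists>r. t = p + r * a)"
      using generated_superset[of T] unfolding T(2)[symmetric] adjoin_def by blast
    then obtain p where p: "\<And>t. t \<in> T \<Longrightarrow> p t \<in> P" "\<And>t. t \<in> T \<Longrightarrow> \<exists>r. t = p t + r * a"
      by metis
    define D where "D = {x. x * a \<in> P}"
    have "type_ideal D"
      unfolding type_ideal_iff D_def
      by (auto simp: distrib_right mult.assoc intro: type_idealD[OF P(1)])
    moreover have "P \<subset> D"
      using nab ab type_idealD(4)[OF P(1)] by (auto simp: D_def mult.commute)
    ultimately obtain U where U: "finite U" "D = generated U"
      using larger by blast
    \<comment> \<open>If \<open>x \<in> P\<close> equals \<open>w + r * a\<close> with \<open>w\<close> generated by \<open>p ` T\<close>, then \<open>r * a \<in> P\<close>, that is, \<open>r \<in> D\<close>.\<close>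
    define W where "W = p ` T \<union> (\<lambda>u. u * a) ` U"
    note W = generated_ideal[of W] generated_superset[of W]
    have "W \<subseteq> P"
      using p(1) generated_superset[of U] unfolding W_def U(2)[symmetric] D_def by auto
    then have sub: "generated W \<subseteq> P" by (rule generated_minimal[OF P(1)])
    have "adjoin P a \<subseteq> adjoin (generated W) a"
      unfolding T(2)
    proof (rule generated_minimal[OF adjoin_ideal[OF W(1)]])
      show "T \<subseteq> adjoin (generated W) a"
      proof
        fix t assume t: "t \<in> T"
        then have "p t \<in> generated W" using W(2) by (auto simp: W_def)
        then show "t \<in> adjoin (generated W) a"
          using p(2)[OF t] unfolding adjoin_def by blast
      qed
    qed
    moreover have "D \<subseteq> {y. y * a \<in> generated W}"
      unfolding U(2)
    proof (rule generated_minimal)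
      show "type_ideal {y. y * a \<in> generated W}"
        unfolding type_ideal_iff
        by (auto simp: distrib_right mult.assoc intro: type_idealD[OF W(1)])
      show "U \<subseteq> {y. y * a \<in> generated W}"
        using W(2) by (auto simp: W_def)
    qed
    ultimately have "P \<subseteq> generated W"
    proof (intro subsetI)
      fix x assume x: "x \<in> P" and *: "adjoin P a \<subseteq> adjoin (generated W) a"
        "D \<subseteq> {y. y * a \<in> generated W}"
      then obtain w r where w: "x = w + r * a" "w \<in> generated W"
        using adjoin_superset[of P a] unfolding adjoin_def[of "generated W"] by blast
      then have "r * a = x - w" by simp
      then have "r \<in> D" using x w(2) sub type_idealD(6)[OF P(1), of x w] unfolding D_def by auto
      then show "x \<in> generated W" using w * type_idealD(2)[OF W(1)] by auto
    qed
    then have "P = generated W" using sub by blast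
    moreover have "finite W" using T U by (simp add: W_def)
    ultimately show False using P(3) by blast
  qed
  moreover have "1 \<notin> P"
  proof
    assume "1 \<in> P"
    moreover have "(1::'a) \<in> generated {1}" using generated_superset by blast
    ultimately have "P = generated {1}"
      using type_ideal_eq_UNIV_iff[OF P(1)] type_ideal_eq_UNIV_iff[OF generated_ideal, of "{1}"]
      by metis
    then show False using P(3) by blast
  qed
  ultimately have "type_prime P" using P(1) by (simp add: type_prime_iff)
  then show False using primes P by blast
qed

section \<open>Localizing a quotient at a prime\<close>

text \<open>The localization of the quotient by \<open>I\<close> at \<open>M\<close> is handled through fractions \<open>x / s\<close> of elements of
  the ring itself. Equality of fractions, and with it all computations, then takes place in the
  ring, with equations modulo \<open>I\<close> in place of equations between cosets.\<close>

locale local_quotient =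
  fixes I M :: "'a::comm_ring_1 set"
  assumes I: "type_ideal I" and M: "type_prime M" and IM: "I \<subseteq> M"
begin

abbreviation residue :: "'a \<Rightarrow> 'a set" where
  "residue x \<equiv> a_r_coset ring_of_type_algebra I x"

abbreviation Q :: "'a set ring" where
  "Q \<equiv> ring_of_type_algebra Quot I"

definition B :: "('a set \<times> 'a set) set ring" where
  "B = localization Q (residue ` (- M))"

definition frac :: "'a \<Rightarrow> 'a \<Rightarrow> ('a set \<times> 'a set) set" where
  "frac x s = loc_frac Q (residue ` (- M)) (residue x) (residue s)"

lemmas I_simps = type_idealD[OF I]

lemma M_ideal: "type_ideal M"
  using M by (simp add: type_prime_iff)

lemma one_notin_M: "1 \<notin> M"
  using M by (simp add: type_prime_iff)

lemma mult_notin_M_iff: "s * t \<notin> M \<longleftrightarrow> s \<notin> M \<and> t \<notin> M"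
  using M type_idealD(3,4)[OF M_ideal] by (auto simp: type_prime_iff)

lemma mem_residue_iff: "y \<in> residue x \<longleftrightarrow> y - x \<in> I"
proof -
  have "residue x = {i + x | i. i \<in> I}" by (auto simp: a_r_coset_def')
  moreover have "y = (y - x) + x" by simp
  ultimately show ?thesis by fastforce
qed

lemma residue_eq_iff: "residue x = residue y \<longleftrightarrow> x - y \<in> I"
proof
  assume "residue x = residue y"
  moreover have "x \<in> residue x" using I_simps(1) by (simp add: mem_residue_iff)
  ultimately show "x - y \<in> I" by (simp add: mem_residue_iff)
next
  assume *: "x - y \<in> I"
  show "residue x = residue y"
  proof (rule Set.set_eqI)
    fix z
    show "z \<in> residue x \<longleftrightarrow> z \<in> residue y"
      using I_simps(2)[OF _ *, of "z - x"] I_simps(6)[OF _ *, of "z - y"]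
      by (auto simp: mem_residue_iff)
  qed
qed

lemma carrier_Q: "carrier Q = range residue"
  by (auto simp: FactRing_def A_RCOSETS_def')

lemma residue_mult: "residue x \<otimes>\<^bsub>Q\<^esub> residue y = residue (x * y)"
  using ideal.rcoset_mult_add[OF I, of x y] by (simp add: FactRing_def)

lemma residue_add: "residue x \<oplus>\<^bsub>Q\<^esub> residue y = residue (x + y)"
  using ideal.a_rcos_sum[OF I, of x y] by (simp add: FactRing_def)

lemma residue_one: "\<one>\<^bsub>Q\<^esub> = residue 1"
  by (simp add: FactRing_def)

lemma residue_zero: "\<zero>\<^bsub>Q\<^esub> = residue 0"
  by (simp add: FactRing_def a_r_coset_def')

lemma residue_in_image_M_iff: "residue x \<in> residue ` M \<longleftrightarrow> x \<in> M"
proof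
  assume "residue x \<in> residue ` M"
  then obtain y where "y \<in> M" "x - y \<in> I" by (auto simp: residue_eq_iff)
  then have "(x - y) + y \<in> M" using IM type_idealD(2)[OF M_ideal] by blast
  then show "x \<in> M" by simp
next
  assume "x \<in> M"
  then show "residue x \<in> residue ` M" by (rule imageI)
qed

lemma denominators: "carrier Q - residue ` M = residue ` (- M)"
proof (intro equalityI subsetI)
  fix a assume "a \<in> carrier Q - residue ` M"
  then obtain x where "a = residue x" "residue x \<notin> residue ` M"
    unfolding carrier_Q by blast
  then show "a \<in> residue ` (- M)" by auto
next
  fix a assume "a \<in> residue ` (- M)"
  then obtain x where "a = residue x" "x \<notin> M" by blast
  then show "a \<in> carrier Q - residue ` M"
    using residue_in_image_M_iff[of x] carrier_Q by simp
qed

text \<open>A fraction is a class of pairs of cosets; here its members are described by representatives, so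
  that \<open>I\<close> and \<open>M\<close> are all that remains of quotient and localization.\<close>

lemma frac_as_set:
  assumes "s \<notin> M"
  shows "frac x s = {(residue y, residue t) | y t. t \<notin> M \<and> (\<exists>u. u \<notin> M \<and> u * (x * t - y * s) \<in> I)}"
proof -
  have *: "(\<exists>u\<in>residue ` (- M). u \<otimes>\<^bsub>Q\<^esub> (residue x \<otimes>\<^bsub>Q\<^esub> residue t) =
      u \<otimes>\<^bsub>Q\<^esub> (residue y \<otimes>\<^bsub>Q\<^esub> residue s)) \<longleftrightarrow> (\<exists>u. u \<notin> M \<and> u * (x * t - y * s) \<in> I)" for y t
  proof -
    have "u * (x * t - y * s) = u * (x * t) - u * (y * s)" for u by (rule right_diff_distrib)
    then show ?thesis by (simp add: residue_mult residue_eq_iff Bex_def)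
  qed
  have "residue s \<in> residue ` (- M)" using assms by blast
  then have "frac x s = {(b, t'). b \<in> range residue \<and> t' \<in> residue ` (- M) \<and>
      (\<exists>u\<in>residue ` (- M). u \<otimes>\<^bsub>Q\<^esub> (residue x \<otimes>\<^bsub>Q\<^esub> t') = u \<otimes>\<^bsub>Q\<^esub> (b \<otimes>\<^bsub>Q\<^esub> residue s))}"
    unfolding frac_def loc_frac_def loc_rel_def carrier_Q
    by (simp add: Image_singleton)
  also have "\<dots> = {(residue y, residue t) | y t. t \<notin> M \<and> (\<exists>u\<in>residue ` (- M).
      u \<otimes>\<^bsub>Q\<^esub> (residue x \<otimes>\<^bsub>Q\<^esub> residue t) = u \<otimes>\<^bsub>Q\<^esub> (residue y \<otimes>\<^bsub>Q\<^esub> residue s))}"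
    by blast
  finally show ?thesis unfolding * .
qed

lemma frac_eq_iff:
  assumes "s \<notin> M" "t \<notin> M"
  shows "frac x s = frac y t \<longleftrightarrow> (\<exists>u. u \<notin> M \<and> u * (x * t - y * s) \<in> I)"
proof
  assume "frac x s = frac y t"
  moreover have "(residue y, residue t) \<in> frac y t"
  proof -
    have "1 * (y * t - y * t) \<in> I" using I_simps(1) by simp
    then show ?thesis
      unfolding frac_as_set[OF assms(2)] using assms(2) one_notin_M by blast
  qed
  ultimately have "(residue y, residue t) \<in> frac x s" by simp
  then have "\<exists>y' t'. (residue y, residue t) = (residue y', residue t') \<and>
      t' \<notin> M \<and> (\<exists>u. u \<notin> M \<and> u * (x * t' - y' * s) \<in> I)"
    unfolding frac_as_set[OF assms(1)] by (simp only: mem_Collect_eq)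
  then obtain y' t' u where *: "y - y' \<in> I" "t - t' \<in> I" "t' \<notin> M" "u \<notin> M"
      "u * (x * t' - y' * s) \<in> I"
    unfolding prod.inject residue_eq_iff by (elim exE conjE) (rule that)
  have "u * (x * t - y * s) = u * (x * t' - y' * s) + (u * x) * (t - t') - (u * s) * (y - y')"
    by (simp add: algebra_simps)
  also have "\<dots> \<in> I" by (intro I_simps(2,6) I_simps(3) *)
  finally show "\<exists>u. u \<notin> M \<and> u * (x * t - y * s) \<in> I" using *(4) by blast
next
  have sub: "frac y t \<subseteq> frac x s"
    if uv: "s \<notin> M" "t \<notin> M" "u \<notin> M" "u * (x * t - y * s) \<in> I" for x y s t u
  proof
    fix p assume "p \<in> frac y t"
    then obtain z w v where z: "p = (residue z, residue w)" "w \<notin> M" "v \<notin> M" "v * (y * w - z * t) \<in> I"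
      unfolding frac_as_set[OF uv(2)] by blast
    have "(u * v * t) * (x * w - z * s) = (v * w) * (u * (x * t - y * s)) + (u * s) * (v * (y * w - z * t))"
      by (simp add: algebra_simps)
    also have "\<dots> \<in> I" by (intro I_simps(2) I_simps(3) uv z)
    finally have "(u * v * t) * (x * w - z * s) \<in> I" .
    moreover have "u * v * t \<notin> M" using uv z by (simp add: mult_notin_M_iff)
    ultimately show "p \<in> frac x s"
      unfolding frac_as_set[OF uv(1)] using z by blast
  qed
  assume "\<exists>u. u \<notin> M \<and> u * (x * t - y * s) \<in> I"
  then obtain u where u: "u \<notin> M" "u * (x * t - y * s) \<in> I" by blast
  then have "u * (y * s - x * t) \<in> I"
    using I_simps(5)[OF u(2)] by (simp add: algebra_simps)
  then show "frac x s = frac y t"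
    using sub[OF assms u] sub[OF assms(2,1) u(1)] by blast
qed

lemma frac_eq_by_witness:
  "s \<notin> M \<Longrightarrow> t \<notin> M \<Longrightarrow> u \<notin> M \<Longrightarrow> u * (x * t - y * s) \<in> I \<Longrightarrow> frac x s = frac y t"
  using frac_eq_iff by blast

lemma frac_eqI:
  assumes "s \<notin> M" "t \<notin> M" "x * t = y * s"
  shows "frac x s = frac y t"
proof -
  have "1 * (x * t - y * s) \<in> I" using assms(3) I_simps(1) by simp
  then show ?thesis unfolding frac_eq_iff[OF assms(1,2)] using one_notin_M by blast
qed

lemma frac_eq_zero_iff: "s \<notin> M \<Longrightarrow> frac x s = frac 0 1 \<longleftrightarrow> (\<exists>u. u \<notin> M \<and> u * x \<in> I)"
  using one_notin_M by (simp add: frac_eq_iff)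

lemma mem_frac: "s \<notin> M \<Longrightarrow> p \<in> frac x s \<longleftrightarrow>
    (\<exists>y t. p = (residue y, residue t) \<and> t \<notin> M \<and> frac y t = frac x s)"
proof -
  assume s: "s \<notin> M"
  have *: "t \<notin> M \<Longrightarrow> frac y t = frac x s \<longleftrightarrow> (\<exists>u. u \<notin> M \<and> u * (x * t - y * s) \<in> I)" for y t
    using frac_eq_iff[OF s, of t x y] by (simp add: eq_commute)
  show ?thesis by (subst frac_as_set[OF s]) (simp add: * cong: conj_cong)
qed

lemma carrier_B: "carrier B = {frac x s | x s. s \<notin> M}"
proof -
  have "carrier B = {loc_frac Q (residue ` (- M)) a s | a s. a \<in> range residue \<and> s \<in> residue ` (- M)}"
    by (simp add: B_def localization_def carrier_Q)
  also have "\<dots> = {frac x s | x s. s \<notin> M}"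
    unfolding frac_def by (rule equalityI; clarify; metis imageI rangeI ComplI)
  finally show ?thesis .
qed

lemma frac_closed: "s \<notin> M \<Longrightarrow> frac x s \<in> carrier B"
  by (auto simp: carrier_B)

lemma one_B: "\<one>\<^bsub>B\<^esub> = frac 1 1"
  by (simp add: B_def localization_def frac_def residue_one)

lemma zero_B: "\<zero>\<^bsub>B\<^esub> = frac 0 1"
  by (simp add: B_def localization_def frac_def residue_one residue_zero)

lemma UN_eq_const: "U \<noteq> {} \<Longrightarrow> (\<And>p. p \<in> U \<Longrightarrow> h p = c) \<Longrightarrow> (\<Union>p\<in>U. h p) = c"
  by auto

lemma frac_nonempty: "s \<notin> M \<Longrightarrow> frac x s \<noteq> {}"
  using mem_frac[of s "(residue x, residue s)" x] by blast

text \<open>The product in the localization is a union over all pairs of representatives of the two factors.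
  It is a single fraction because all these representatives give the same one.\<close>

lemma mult_B:
  assumes "s \<notin> M" "t \<notin> M"
  shows "frac x s \<otimes>\<^bsub>B\<^esub> frac y t = frac (x * y) (s * t)"
proof -
  have "frac x s \<otimes>\<^bsub>B\<^esub> frac y t = (\<Union>(a, s)\<in>frac x s. \<Union>(b, t)\<in>frac y t.
      loc_frac Q (residue ` (- M)) (a \<otimes>\<^bsub>Q\<^esub> b) (s \<otimes>\<^bsub>Q\<^esub> t))"
    unfolding B_def localization_def monoid.select_convs ring.select_convs ..
  also have "\<dots> = frac (x * y) (s * t)"
  proof (intro UN_eq_const frac_nonempty assms; clarify; intro UN_eq_const frac_nonempty assms; clarify)
    fix a s' b t' assume "(a, s') \<in> frac x s" "(b, t') \<in> frac y t"
    then obtain x' s'' y' t'' where *: "a = residue x'" "s' = residue s''" "s'' \<notin> M" "frac x' s'' = frac x s"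
      "b = residue y'" "t' = residue t''" "t'' \<notin> M" "frac y' t'' = frac y t"
      unfolding mem_frac[OF assms(1)] mem_frac[OF assms(2)] prod.inject by (elim exE conjE) (rule that)
    then obtain u v where uv: "u \<notin> M" "u * (x' * s - x * s'') \<in> I" "v \<notin> M" "v * (y' * t - y * t'') \<in> I"
      using frac_eq_iff[OF *(3) assms(1), of x' x] frac_eq_iff[OF *(7) assms(2), of y' y] by auto
    have "(u * v) * ((x' * y') * (s * t) - (x * y) * (s'' * t'')) =
        (v * y' * t) * (u * (x' * s - x * s'')) + (u * x * s'') * (v * (y' * t - y * t''))"
      by (simp add: algebra_simps)
    also have "\<dots> \<in> I" by (intro I_simps(2) I_simps(3) uv)
    finally have "frac (x' * y') (s'' * t'') = frac (x * y) (s * t)"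
      using uv(1,3) *(3,7) assms by (intro frac_eq_by_witness[of _ _ "u * v"]) (simp_all add: mult_notin_M_iff)
    then show "loc_frac Q (residue ` (- M)) (a \<otimes>\<^bsub>Q\<^esub> b) (s' \<otimes>\<^bsub>Q\<^esub> t') = frac (x * y) (s * t)"
      by (simp add: * residue_mult frac_def)
  qed
  finally show ?thesis .
qed

lemma add_B:
  assumes "s \<notin> M" "t \<notin> M"
  shows "frac x s \<oplus>\<^bsub>B\<^esub> frac y t = frac (x * t + y * s) (s * t)"
proof -
  have "frac x s \<oplus>\<^bsub>B\<^esub> frac y t = (\<Union>(a, s)\<in>frac x s. \<Union>(b, t)\<in>frac y t.
      loc_frac Q (residue ` (- M)) (a \<otimes>\<^bsub>Q\<^esub> t \<oplus>\<^bsub>Q\<^esub> b \<otimes>\<^bsub>Q\<^esub> s) (s \<otimes>\<^bsub>Q\<^esub> t))"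
    unfolding B_def localization_def monoid.select_convs ring.select_convs ..
  also have "\<dots> = frac (x * t + y * s) (s * t)"
  proof (intro UN_eq_const frac_nonempty assms; clarify; intro UN_eq_const frac_nonempty assms; clarify)
    fix a s' b t' assume "(a, s') \<in> frac x s" "(b, t') \<in> frac y t"
    then obtain x' s'' y' t'' where *: "a = residue x'" "s' = residue s''" "s'' \<notin> M" "frac x' s'' = frac x s"
      "b = residue y'" "t' = residue t''" "t'' \<notin> M" "frac y' t'' = frac y t"
      unfolding mem_frac[OF assms(1)] mem_frac[OF assms(2)] prod.inject by (elim exE conjE) (rule that)
    then obtain u v where uv: "u \<notin> M" "u * (x' * s - x * s'') \<in> I" "v \<notin> M" "v * (y' * t - y * t'') \<in> I"
      using frac_eq_iff[OF *(3) assms(1), of x' x] frac_eq_iff[OF *(7) assms(2), of y' y] by auto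
    have "(u * v) * ((x' * t'' + y' * s'') * (s * t) - (x * t + y * s) * (s'' * t'')) =
        (v * t * t'') * (u * (x' * s - x * s'')) + (u * s * s'') * (v * (y' * t - y * t''))"
      by (simp add: algebra_simps)
    also have "\<dots> \<in> I" by (intro I_simps(2) I_simps(3) uv)
    finally have "frac (x' * t'' + y' * s'') (s'' * t'') = frac (x * t + y * s) (s * t)"
      using uv(1,3) *(3,7) assms by (intro frac_eq_by_witness[of _ _ "u * v"]) (simp_all add: mult_notin_M_iff)
    then show "loc_frac Q (residue ` (- M)) (a \<otimes>\<^bsub>Q\<^esub> t' \<oplus>\<^bsub>Q\<^esub> b \<otimes>\<^bsub>Q\<^esub> s') (s' \<otimes>\<^bsub>Q\<^esub> t') =
        frac (x * t + y * s) (s * t)"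
      by (simp add: * residue_mult residue_add frac_def)
  qed
  finally show ?thesis .
qed

lemma frac_cases:
  assumes "b \<in> carrier B"
  obtains x s where "b = frac x s" "s \<notin> M"
  using assms by (auto simp: carrier_B)

lemmas B_simps = mult_B add_B one_B zero_B frac_closed mult_notin_M_iff one_notin_M

lemma cring_B: "cring B"
proof (rule cringI)
  show "abelian_group B"
  proof (rule abelian_groupI)
    fix a assume "a \<in> carrier B"
    then obtain x s where x: "a = frac x s" "s \<notin> M" by (rule frac_cases)
    then have "frac (- x) s \<oplus>\<^bsub>B\<^esub> a = \<zero>\<^bsub>B\<^esub>"
      by (simp add: B_simps) (rule frac_eqI; simp add: B_simps)
    then show "\<exists>b\<in>carrier B. b \<oplus>\<^bsub>B\<^esub> a = \<zero>\<^bsub>B\<^esub>"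
      using frac_closed[OF x(2)] by blast
  qed ((elim frac_cases)?; simp add: B_simps; (rule frac_eqI; simp add: B_simps algebra_simps)?)+
  show "comm_monoid B"
    by (rule comm_monoidI)
      ((elim frac_cases)?; simp add: B_simps; (rule frac_eqI; simp add: B_simps algebra_simps)?)+
qed ((elim frac_cases)?; simp add: B_simps; rule frac_eqI; simp add: B_simps algebra_simps)

interpretation B: cring B by (rule cring_B)

text \<open>Contraction and extension along the canonical map from the ring to the localization. Contraction
  embeds the ideals of the localization, with their inclusions, into the ideals above \<open>I\<close>; on primes
  below \<open>M\<close> extension inverts it. Chains of primes and finite generation can thus be studied in the
  ring itself.\<close>

definition contraction :: "('a set \<times> 'a set) set set \<Rightarrow> 'a set" where
  "contraction J = {x. frac x 1 \<in> J}"

definition extension :: "'a set \<Rightarrow> ('a set \<times> 'a set) set set" where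
  "extension P = {frac x s | x s. x \<in> P \<and> s \<notin> M}"

lemma ideal_B_D:
  assumes "ideal J B"
  shows "frac 0 1 \<in> J" "a \<in> J \<Longrightarrow> b \<in> J \<Longrightarrow> a \<oplus>\<^bsub>B\<^esub> b \<in> J"
    "r \<in> carrier B \<Longrightarrow> a \<in> J \<Longrightarrow> r \<otimes>\<^bsub>B\<^esub> a \<in> J" "J \<subseteq> carrier B"
proof -
  interpret J: ideal J B by (rule assms)
  show "frac 0 1 \<in> J"
    using additive_subgroup.zero_closed[OF J.is_additive_subgroup] by (simp add: zero_B)
  show "a \<in> J \<Longrightarrow> b \<in> J \<Longrightarrow> a \<oplus>\<^bsub>B\<^esub> b \<in> J"
    by (rule additive_subgroup.a_closed[OF J.is_additive_subgroup])
  show "r \<in> carrier B \<Longrightarrow> a \<in> J \<Longrightarrow> r \<otimes>\<^bsub>B\<^esub> a \<in> J" by (rule J.I_l_closed)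
  show "J \<subseteq> carrier B" by (rule additive_subgroup.a_subset[OF J.is_additive_subgroup])
qed

lemma contraction_ideal: assumes "ideal J B" shows "type_ideal (contraction J)"
  unfolding type_ideal_iff contraction_def mem_Collect_eq
proof (intro conjI ballI allI; (unfold mem_Collect_eq)?)
  note J = ideal_B_D[OF assms]
  show "frac 0 1 \<in> J" by (rule J)
  show "frac (x + y) 1 \<in> J" if "frac x 1 \<in> J" "frac y 1 \<in> J" for x y
    using J(2)[OF that] by (simp add: B_simps)
  show "frac (r * x) 1 \<in> J" if "frac x 1 \<in> J" for r x
    using J(3)[OF frac_closed[OF one_notin_M] that, of r] by (simp add: B_simps)
qed

lemma I_subset_contraction: assumes "ideal J B" shows "I \<subseteq> contraction J"
proof
  fix x assume "x \<in> I"
  then have "frac x 1 = frac 0 1"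
    using one_notin_M by (intro frac_eq_by_witness[of _ _ 1]) auto
  then show "x \<in> contraction J"
    using ideal_B_D(1)[OF assms] by (simp add: contraction_def)
qed

lemma frac_mem_ideal_iff:
  assumes "ideal J B" "s \<notin> M"
  shows "frac x s \<in> J \<longleftrightarrow> x \<in> contraction J"
proof -
  note J = ideal_B_D[OF assms(1)]
  have "frac x 1 = frac s 1 \<otimes>\<^bsub>B\<^esub> frac x s"
    using assms(2) by (simp add: B_simps) (rule frac_eqI; simp add: B_simps)
  moreover have "frac x s = frac 1 s \<otimes>\<^bsub>B\<^esub> frac x 1"
    using assms(2) by (simp add: B_simps)
  ultimately show ?thesis
    unfolding contraction_def mem_Collect_eq using J(3) frac_closed assms(2) one_notin_M by metis
qed

lemma ideal_subset_iff_contraction: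
  assumes "ideal J B" "ideal K B"
  shows "J \<subseteq> K \<longleftrightarrow> contraction J \<subseteq> contraction K"
proof
  assume "J \<subseteq> K" then show "contraction J \<subseteq> contraction K"
    by (auto simp: contraction_def)
next
  assume *: "contraction J \<subseteq> contraction K"
  show "J \<subseteq> K"
  proof
    fix a assume a: "a \<in> J"
    then obtain x s where "a = frac x s" "s \<notin> M"
      using ideal_B_D(4)[OF assms(1)] by (blast elim: frac_cases)
    then show "a \<in> K" using a * frac_mem_ideal_iff assms by blast
  qed
qed

lemma contraction_subset_M:
  assumes "ideal J B" "J \<noteq> carrier B"
  shows "contraction J \<subseteq> M"
proof
  fix x assume x: "x \<in> contraction J"
  show "x \<in> M"
  proof (rule ccontr)
    assume "x \<notin> M"
    then have "frac x x \<in> J" using x frac_mem_ideal_iff assms(1) by blast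
    moreover have "frac x x = \<one>\<^bsub>B\<^esub>"
      unfolding one_B using \<open>x \<notin> M\<close> one_notin_M by (intro frac_eqI) auto
    ultimately have "\<one>\<^bsub>B\<^esub> \<in> J" by simp
    then show False using ideal.one_imp_carrier[OF assms(1)] assms(2) by blast
  qed
qed

lemma contraction_prime: assumes "primeideal P B" shows "type_prime (contraction P)"
proof -
  interpret P: primeideal P B by (rule assms)
  have "contraction P \<subseteq> M"
    using contraction_subset_M[OF P.is_ideal] P.I_notcarr by blast
  then have "1 \<notin> contraction P" using one_notin_M by blast
  moreover have "x \<in> contraction P \<or> y \<in> contraction P" if "x * y \<in> contraction P" for x y
  proof -
    have "frac x 1 \<otimes>\<^bsub>B\<^esub> frac y 1 \<in> P"
      using that by (simp add: contraction_def B_simps)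
    then show ?thesis
      unfolding contraction_def mem_Collect_eq
      by (rule P.I_prime[OF frac_closed[OF one_notin_M] frac_closed[OF one_notin_M]])
  qed
  ultimately show ?thesis
    using contraction_ideal[OF P.is_ideal] by (simp add: type_prime_iff)
qed

lemma extension_ideal: assumes "type_ideal P" shows "ideal (extension P) B"
proof (rule B.ideal_by_closure)
  note P = type_idealD[OF assms]
  show "extension P \<subseteq> carrier B" by (auto simp: extension_def frac_closed)
  show "\<zero>\<^bsub>B\<^esub> \<in> extension P"
    unfolding extension_def zero_B using P(1) one_notin_M by blast
  show "a \<oplus>\<^bsub>B\<^esub> b \<in> extension P" if ab: "a \<in> extension P" "b \<in> extension P" for a b
  proof -
    obtain x s y t where *: "a = frac x s" "b = frac y t" "x \<in> P" "y \<in> P" "s \<notin> M" "t \<notin> M"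
      using ab unfolding extension_def by blast
    then have "x * t + y * s \<in> P" "s * t \<notin> M" by (auto simp: P mult_notin_M_iff)
    then show ?thesis unfolding * add_B[OF *(5,6)] extension_def by blast
  qed
  show "r \<otimes>\<^bsub>B\<^esub> a \<in> extension P" if ra: "r \<in> carrier B" "a \<in> extension P" for r a
  proof -
    obtain x s y t where *: "r = frac x s" "a = frac y t" "y \<in> P" "s \<notin> M" "t \<notin> M"
      using ra unfolding extension_def by (blast elim: frac_cases)
    then have "x * y \<in> P" "s * t \<notin> M" by (auto simp: P mult_notin_M_iff)
    then show ?thesis unfolding *(1,2) mult_B[OF *(4,5)] extension_def by blast
  qed
qed

lemma contraction_extension:
  assumes "type_prime P" "I \<subseteq> P" "P \<subseteq> M"
  shows "contraction (extension P) = P"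
proof
  show "P \<subseteq> contraction (extension P)"
    unfolding contraction_def extension_def using one_notin_M by blast
  show "contraction (extension P) \<subseteq> P"
  proof
    fix x assume "x \<in> contraction (extension P)"
    then obtain y s where y: "frac x 1 = frac y s" "y \<in> P" "s \<notin> M"
      unfolding contraction_def extension_def by blast
    then obtain u where u: "u \<notin> M" "u * (x * s - y * 1) \<in> I"
      using frac_eq_iff[OF one_notin_M y(3), of x y] by blast
    have P: "type_ideal P" using assms(1) by (simp add: type_prime_iff)
    have "(u * s) * x = u * (x * s - y * 1) + u * y" by (simp add: algebra_simps)
    also have "\<dots> \<in> P"
      by (rule type_idealD(2)[OF P subsetD[OF assms(2) u(2)] type_idealD(3)[OF P y(2)]])
    finally have "(u * s) * x \<in> P" .
    moreover have "u * s \<notin> P" using u y assms(3) by (metis mult_notin_M_iff subsetD)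
    ultimately show "x \<in> P" using assms(1) by (auto simp: type_prime_iff)
  qed
qed

lemma extension_prime:
  assumes "type_prime P" "I \<subseteq> P" "P \<subseteq> M"
  shows "primeideal (extension P) B"
proof -
  have P: "type_ideal P" "1 \<notin> P" using assms(1) by (auto simp: type_prime_iff)
  note id = extension_ideal[OF P(1)]
  have mem: "frac x s \<in> extension P \<longleftrightarrow> x \<in> P" if "s \<notin> M" for x s
    using frac_mem_ideal_iff[OF id that] contraction_extension[OF assms] by simp
  show ?thesis
  proof (rule primeidealI[OF id cring_B])
    show "carrier B \<noteq> extension P"
      using mem[OF one_notin_M, of 1] P frac_closed[OF one_notin_M, of 1] by blast
    fix a b assume ab: "a \<in> carrier B" "b \<in> carrier B" "a \<otimes>\<^bsub>B\<^esub> b \<in> extension P"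
    obtain x s y t where *: "a = frac x s" "b = frac y t" "s \<notin> M" "t \<notin> M"
      using ab(1,2) by (blast elim: frac_cases)
    then show "a \<in> extension P \<or> b \<in> extension P"
      using ab(3) assms(1) by (simp add: mem B_simps type_prime_iff)
  qed
qed

lemma ideal_subset_extension_M:
  assumes "ideal J B" "J \<noteq> carrier B"
  shows "J \<subseteq> extension M"
  using contraction_subset_M[OF assms] ideal_subset_iff_contraction[OF assms(1) extension_ideal[OF M_ideal]]
    contraction_extension[OF M IM order_refl] by simp

lemma extension_M_proper: "extension M \<noteq> carrier B"
  using primeideal.I_notcarr[OF extension_prime[OF M IM order_refl]] by blast

lemma extension_M_maximal: "maximalideal (extension M) B"
  using ideal_subset_extension_M extension_M_proper extension_ideal[OF M_ideal]
  by (intro maximalidealI) auto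

lemma maximal_unique: "maximalideal N B \<Longrightarrow> N = extension M"
proof -
  assume "maximalideal N B"
  then interpret N: maximalideal N B .
  have "N \<subseteq> extension M"
    using ideal_subset_extension_M[OF N.is_ideal] N.I_notcarr by blast
  then show ?thesis
    using N.I_maximal[OF extension_ideal[OF M_ideal]] ideal_B_D(4)[OF extension_ideal[OF M_ideal]]
      extension_M_proper by blast
qed

lemma noetherian_B:
  assumes fg: "\<And>J. type_ideal J \<Longrightarrow> I \<subseteq> J \<Longrightarrow> \<exists>T. finite T \<and> J = generated T"
  shows "noetherian_ring B"
proof (intro noetherian_ring.intro B.ring_axioms noetherian_ring_axioms.intro)
  fix J assume J: "ideal J B"
  obtain T where T: "finite T" "contraction J = generated T"
    using fg contraction_ideal[OF J] I_subset_contraction[OF J] by blast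
  define U where "U = (\<lambda>x. frac x 1) ` T"
  have U: "U \<subseteq> carrier B" using frac_closed[OF one_notin_M] by (auto simp: U_def)
  note id = B.genideal_ideal[OF U]
  have "T \<subseteq> contraction (Idl\<^bsub>B\<^esub> U)"
    using B.genideal_self[OF U] by (auto simp: U_def contraction_def)
  then have "contraction J \<subseteq> contraction (Idl\<^bsub>B\<^esub> U)"
    unfolding T(2) by (rule generated_minimal[OF contraction_ideal[OF id]])
  then have "J \<subseteq> Idl\<^bsub>B\<^esub> U" using ideal_subset_iff_contraction[OF J id] by blast
  moreover have "U \<subseteq> J"
    using generated_superset[of T] unfolding T(2)[symmetric] by (auto simp: U_def contraction_def)
  then have "Idl\<^bsub>B\<^esub> U \<subseteq> J" by (rule B.genideal_minimal[OF J])
  ultimately show "\<exists>A\<subseteq>carrier B. finite A \<and> J = Idl\<^bsub>B\<^esub> A"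
    using U T(1) by (intro exI[of _ U]) (auto simp: U_def)
qed

text \<open>A nonzerodivisor modulo \<open>I\<close> avoids every minimal prime over \<open>I\<close>, so \<open>M\<close> is not minimal if it
  contains one. This gives the lower bound for the dimension.\<close>

lemma prime_strictly_below_of_nonzerodivisor:
  assumes f: "f \<in> M" "\<And>a. f * a \<in> I \<Longrightarrow> a \<in> I"
  obtains P where "type_prime P" "I \<subseteq> P" "P \<subset> M"
proof -
  have "s \<in> I" if "s * f ^ k \<in> I" for s k
    using that
  proof (induction k)
    case (Suc k)
    then have "f * (s * f ^ k) \<in> I" by (simp add: ac_simps)
    then show ?case using f(2) Suc.IH by blast
  qed simp
  then have "s * f ^ k \<notin> I" if "s \<notin> M" for s k using IM that by blast
  then obtain P where "type_prime P" "I \<subseteq> P" "P \<subseteq> M" "f \<notin> P"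
    using prime_between_avoiding_element[OF I M] by blast
  then show ?thesis using that f(1) by blast
qed

text \<open>Elements of a minimal prime are nilpotent after localizing there: if \<open>f\<close> lies in the minimal prime
  \<open>P\<close>, then \<open>s * f ^ k \<in> I\<close> for some \<open>s \<notin> P\<close>. If the fraction of \<open>f\<close> were regular, its power could be
  cancelled, and \<open>s\<close> would vanish in the localization at \<open>M\<close>, which forces \<open>s \<in> P\<close>.\<close>

lemma minimal_prime_consists_of_zero_divisors:
  assumes P: "type_prime P" "I \<subseteq> P" "P \<subseteq> M"
    and minimal: "\<And>P'. type_prime P' \<Longrightarrow> I \<subseteq> P' \<Longrightarrow> \<not> P' \<subset> P"
    and reg: "\<And>b. b \<in> carrier B \<Longrightarrow> frac f t \<otimes>\<^bsub>B\<^esub> b = frac 0 1 \<Longrightarrow> b = frac 0 1"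
    and t: "t \<notin> M"
  shows "f \<notin> P"
proof
  assume fP: "f \<in> P"
  have "\<exists>s k. s \<notin> P \<and> s * f ^ k \<in> I"
  proof (rule ccontr)
    assume "\<not> ?thesis"
    then obtain P' where "type_prime P'" "I \<subseteq> P'" "P' \<subseteq> P" "f \<notin> P'"
      using prime_between_avoiding_element[OF I P(1)] by blast
    then show False using minimal[of P'] fP by blast
  qed
  then obtain s k where s: "s \<notin> P" "s * f ^ k \<in> I" by blast
  have zero: "frac s 1 = frac 0 1" if "frac (s * f ^ k) 1 = frac 0 1" for k
    using that
  proof (induction k)
    case (Suc k)
    have "frac f t \<otimes>\<^bsub>B\<^esub> frac (s * f ^ k) 1 = frac 1 t \<otimes>\<^bsub>B\<^esub> frac (s * f ^ Suc k) 1"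
      using t by (simp add: B_simps ac_simps)
    also have "\<dots> = frac 0 t"
      unfolding Suc.prems by (simp add: mult_B[OF t one_notin_M])
    also have "\<dots> = frac 0 1"
      using t one_notin_M by (intro frac_eqI) simp_all
    finally show ?case 
      by (rule Suc.IH[OF reg[OF frac_closed[OF one_notin_M]]])
  qed simp
  have "frac (s * f ^ k) 1 = frac 0 1"
    using s(2) one_notin_M by (intro frac_eq_by_witness[of _ _ 1]) auto
  then obtain u where "u \<notin> M" "u * s \<in> I"
    using zero frac_eq_zero_iff[OF one_notin_M] by blast
  then show False using s(1) P by (auto simp: type_prime_iff)
qed

lemma krull_dim_eq_1:
  assumes dim: "\<And>P P' P''. type_prime P \<Longrightarrow> type_prime P' \<Longrightarrow> type_prime P'' \<Longrightarrow>
      I \<subseteq> P \<Longrightarrow> P \<subset> P' \<Longrightarrow> P' \<subset> P'' \<Longrightarrow> False"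
    and P: "type_prime P" "I \<subseteq> P" "P \<subset> M"
  shows "krull_dim B = 1"
  unfolding krull_dim_def
proof (rule antisym)
  define L where "L i = (if i = 0 then extension P else extension M)" for i :: nat
  have "extension P \<subseteq> extension M" using P(3) by (auto simp: extension_def)
  moreover have "extension P \<noteq> extension M"
    using contraction_extension[OF M IM] contraction_extension[OF P(1,2)] P(3) by fastforce
  ultimately have "extension P \<subset> extension M" by blast
  then have "(\<forall>i\<le>1. primeideal (L i) B) \<and> (\<forall>i<1. L i \<subset> L (Suc i))"
    using extension_prime[OF P(1,2)] extension_prime[OF M IM] P(3) by (auto simp: L_def)
  then have "enat 1 \<in> {enat k |k. \<exists>P. (\<forall>i\<le>k. primeideal (P i) B) \<and> (\<forall>i<k. P i \<subset> P (Suc i))}"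
    by blast
  then show "1 \<le> Sup {enat k |k. \<exists>P. (\<forall>i\<le>k. primeideal (P i) B) \<and> (\<forall>i<k. P i \<subset> P (Suc i))}"
    unfolding one_enat_def by (rule Sup_upper)
  show "Sup {enat k |k. \<exists>P. (\<forall>i\<le>k. primeideal (P i) B) \<and> (\<forall>i<k. P i \<subset> P (Suc i))} \<le> 1"
  proof (rule Sup_least, clarify)
    fix k L assume L: "\<forall>i\<le>k. primeideal (L i) B" "\<forall>i<k. L i \<subset> L (Suc i)"
    show "enat k \<le> 1"
    proof (rule ccontr)
      assume "\<not> enat k \<le> 1"
      then have k: "2 \<le> k" by (simp add: one_enat_def)
      then have pr: "primeideal (L 0) B" "primeideal (L 1) B" "primeideal (L 2) B"
        "L 0 \<subset> L 1" "L 1 \<subset> L 2"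
        using L by (auto simp: numeral_2_eq_2)
      have id: "ideal (L 0) B" "ideal (L 1) B" "ideal (L 2) B"
        using pr(1-3) by (auto intro: primeideal.axioms(1))
      have "contraction (L 0) \<subset> contraction (L 1)" "contraction (L 1) \<subset> contraction (L 2)"
        using pr(4,5) id by (simp_all add: subset_not_subset_eq ideal_subset_iff_contraction)
      then show False
        using dim[OF contraction_prime[OF pr(1)] contraction_prime[OF pr(2)] contraction_prime[OF pr(3)]]
          I_subset_contraction[OF id(1)] by blast
    qed
  qed
qed

lemma genideal_empty: "Idl\<^bsub>B\<^esub> {} = {frac 0 1}"
proof
  show "Idl\<^bsub>B\<^esub> {} \<subseteq> {frac 0 1}"
    using B.genideal_minimal[OF B.zeroideal] by (simp add: zero_B)
  show "{frac 0 1} \<subseteq> Idl\<^bsub>B\<^esub> {}"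
    using ideal_B_D(1)[OF B.genideal_ideal] by blast
qed

text \<open>Let \<open>f\<close> and \<open>g\<close> be the numerators of the first two members of a longer regular sequence. By the
  dimension bound and regularity of \<open>f\<close>, no prime strictly below \<open>M\<close> contains \<open>f\<close>. On the other hand
  the contraction \<open>J\<close> of the ideal generated by the first member contains no \<open>u * g ^ k\<close> with \<open>u \<notin> M\<close>,
  since the factors \<open>g\<close> can be cancelled; this produces a prime above \<open>J\<close> that is below \<open>M\<close> and avoids
  \<open>g\<close>, hence lies strictly below \<open>M\<close>, but contains \<open>f\<close>.\<close>

lemma regular_sequence_length_le_1:
  assumes dim: "\<And>P P' P''. type_prime P \<Longrightarrow> type_prime P' \<Longrightarrow> type_prime P'' \<Longrightarrow>
      I \<subseteq> P \<Longrightarrow> P \<subset> P' \<Longrightarrow> P' \<subset> P'' \<Longrightarrow> False"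
    and xs: "regular_sequence B xs" "set xs \<subseteq> extension M"
  shows "length xs \<le> 1"
proof (rule ccontr)
  assume "\<not> length xs \<le> 1"
  then obtain a b ys where ys: "xs = a # b # ys"
    by (cases xs; cases "tl xs") auto
  obtain f s g t where fg: "a = frac f s" "b = frac g t" "f \<in> M" "g \<in> M" "s \<notin> M" "t \<notin> M"
    using xs(2) unfolding ys extension_def by auto
  have reg: "xs ! i \<otimes>\<^bsub>B\<^esub> c \<in> Idl\<^bsub>B\<^esub> (set (take i xs)) \<Longrightarrow> c \<in> Idl\<^bsub>B\<^esub> (set (take i xs))"
    if "i < length xs" "c \<in> carrier B" for i c
    using xs(1) that unfolding regular_sequence_def by blast
  have reg0: "c = frac 0 1" if "c \<in> carrier B" "frac f s \<otimes>\<^bsub>B\<^esub> c = frac 0 1" for c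
    using reg[of 0 c] that by (simp add: ys fg genideal_empty)
  have reg1: "c \<in> Idl\<^bsub>B\<^esub> {a}" if "c \<in> carrier B" "b \<otimes>\<^bsub>B\<^esub> c \<in> Idl\<^bsub>B\<^esub> {a}" for c
    using reg[of 1 c] that by (simp add: ys)
  have a: "{a} \<subseteq> carrier B" using fg frac_closed by simp
  define J where "J = contraction (Idl\<^bsub>B\<^esub> {a})"
  note id = B.genideal_ideal[OF a]
  have J: "type_ideal J" "I \<subseteq> J"
    unfolding J_def by (rule contraction_ideal[OF id], rule I_subset_contraction[OF id])
  have fJ: "f \<in> J"
    using B.genideal_self[OF a] frac_mem_ideal_iff[OF id fg(5)] by (simp add: fg J_def)
  have "{a} \<subseteq> extension M" using xs(2) ys by simp
  then have "Idl\<^bsub>B\<^esub> {a} \<subseteq> extension M"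
    by (rule B.genideal_minimal[OF extension_ideal[OF M_ideal]])
  then have "Idl\<^bsub>B\<^esub> {a} \<noteq> carrier B"
    using extension_M_proper ideal_B_D(4)[OF extension_ideal[OF M_ideal]] by blast
  then have JM: "J \<subseteq> M" unfolding J_def by (rule contraction_subset_M[OF id])
  have strip: "h \<in> J" if "h * g ^ k \<in> J" for h k
    using that
  proof (induction k)
    case (Suc k)
    have "g * (h * g ^ k) \<in> J" using Suc.prems by (simp add: ac_simps)
    then have "b \<otimes>\<^bsub>B\<^esub> frac (h * g ^ k) 1 \<in> Idl\<^bsub>B\<^esub> {a}"
      using frac_mem_ideal_iff[OF id fg(6)] fg(6) by (simp add: B_simps fg(2) J_def)
    then have "h * g ^ k \<in> J"
      using reg1 frac_closed[OF one_notin_M] by (simp add: J_def contraction_def)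
    then show ?case by (rule Suc.IH)
  qed simp
  have "u * g ^ k \<notin> J" if "u \<notin> M" for u k using strip JM that by blast
  then obtain P where P: "type_prime P" "J \<subseteq> P" "P \<subseteq> M" "g \<notin> P"
    using prime_between_avoiding_element[OF J(1) M] by blast
  then have PM: "P \<subset> M" using fg(4) by blast
  have "f \<notin> P"
  proof (rule minimal_prime_consists_of_zero_divisors)
    show "\<not> P' \<subset> P" if "type_prime P'" "I \<subseteq> P'" for P'
      using dim[OF that(1) P(1) M that(2)] PM by blast
  qed (use P J PM fg reg0 in auto)
  then show False using fJ P(2) by blast
qed

lemma cohen_macaulay_local_ring_B:
  assumes fg: "\<And>J. type_ideal J \<Longrightarrow> I \<subseteq> J \<Longrightarrow> \<exists>T. finite T \<and> J = generated T"
    and dim: "\<And>P P' P''. type_prime P \<Longrightarrow> type_prime P' \<Longrightarrow> type_prime P'' \<Longrightarrow>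
      I \<subseteq> P \<Longrightarrow> P \<subset> P' \<Longrightarrow> P' \<subset> P'' \<Longrightarrow> False"
    and f: "f \<in> M" "\<And>a. f * a \<in> I \<Longrightarrow> a \<in> I"
  shows "cohen_macaulay_local_ring B"
proof -
  obtain P where P: "type_prime P" "I \<subseteq> P" "P \<subset> M"
    using prime_strictly_below_of_nonzerodivisor[OF f] by blast
  have "regular_sequence B [frac f 1]"
    unfolding regular_sequence_def
  proof (intro conjI allI ballI impI)
    have mem: "frac f 1 \<in> extension M"
      using f(1) one_notin_M unfolding extension_def by blast
    then have "Idl\<^bsub>B\<^esub> {frac f 1} \<subseteq> extension M"
      using B.genideal_minimal[OF extension_ideal[OF M_ideal]] by simp
    then show "Idl\<^bsub>B\<^esub> (set [frac f 1]) \<noteq> carrier B"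
      using extension_M_proper ideal_B_D(4)[OF extension_ideal[OF M_ideal]] by auto
    show "set [frac f 1] \<subseteq> carrier B" using frac_closed[OF one_notin_M] by simp
    fix i b assume i: "i < length [frac f 1]" and b: "b \<in> carrier B"
      and *: "[frac f 1] ! i \<otimes>\<^bsub>B\<^esub> b \<in> Idl\<^bsub>B\<^esub> (set (take i [frac f 1]))"
    obtain x s where x: "b = frac x s" "s \<notin> M" using b by (rule frac_cases)
    then have "frac (f * x) s = frac 0 1"
      using i * by (simp add: genideal_empty B_simps)
    then obtain u where u: "u \<notin> M" "u * (f * x) \<in> I"
      using frac_eq_zero_iff[OF x(2)] by blast
    then have "u * x \<in> I" using f(2)[of "u * x"] by (simp add: ac_simps)
    then have "b = frac 0 1" using frac_eq_zero_iff[OF x(2)] u(1) x(1) by blast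
    then show "b \<in> Idl\<^bsub>B\<^esub> (set (take i [frac f 1]))"
      using i by (simp add: genideal_empty)
  qed
  moreover have "frac f 1 \<in> extension M"
    using f(1) one_notin_M unfolding extension_def by blast
  ultimately have mem: "enat 1 \<in> {enat (length xs) | xs. regular_sequence B xs \<and> set xs \<subseteq> extension M}"
    by (intro CollectI exI[of _ "[frac f 1]"]) simp
  have "depth_on (extension M) B = 1"
    unfolding depth_on_def
  proof (rule antisym)
    show "1 \<le> Sup {enat (length xs) | xs. regular_sequence B xs \<and> set xs \<subseteq> extension M}"
      using mem unfolding one_enat_def by (rule Sup_upper)
    show "Sup {enat (length xs) | xs. regular_sequence B xs \<and> set xs \<subseteq> extension M} \<le> 1"
      using regular_sequence_length_le_1[OF dim] by (intro Sup_least) (auto simp: one_enat_def)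
  qed
  moreover have "krull_dim B = 1" by (rule krull_dim_eq_1[OF dim P])
  ultimately show ?thesis
    unfolding cohen_macaulay_local_ring_def
    using cring_B noetherian_B[OF fg] extension_M_maximal
    by (intro conjI exI[of _ "extension M"] allI impI maximal_unique) simp_all
qed

end

section \<open>A criterion in dimension one\<close>

text \<open>The hypothesis \<open>dim\<close> bounds the dimension by one, and \<open>nonzerodivisor\<close> says that no maximal ideal is
  associated. The latter also excludes components of dimension zero, so every localization has
  dimension and depth exactly one.\<close>

theorem cohen_macaulay_ideal_of_dimension_one:
  fixes I :: "'a::comm_ring_1 set"
  assumes I: "type_ideal I"
    and fg: "\<And>P. type_prime P \<Longrightarrow> I \<subseteq> P \<Longrightarrow> \<exists>T. finite T \<and> P = generated T"
    and dim: "\<And>P P' P''. type_prime P \<Longrightarrow> type_prime P' \<Longrightarrow> type_prime P'' \<Longrightarrow>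
      I \<subseteq> P \<Longrightarrow> P \<subset> P' \<Longrightarrow> P' \<subset> P'' \<Longrightarrow> False"
    and nonzerodivisor: "\<And>M. type_maximal M \<Longrightarrow> I \<subseteq> M \<Longrightarrow> \<exists>f\<in>M. \<forall>a. f * a \<in> I \<longrightarrow> a \<in> I"
  shows "cohen_macaulay_ideal I ring_of_type_algebra"
proof -
  let ?R = "ring_of_type_algebra :: 'a ring"
  let ?Q = "?R Quot I"
  interpret I: ideal I ?R by (rule I)
  interpret h: ring_hom_ring ?R ?Q "\<lambda>x. a_r_coset ?R I x"
    by (rule I.rcos_ring_hom_ring)
  have cring: "cring ?Q"
    by (rule I.quotient_is_cring[OF cring_from_type_algebra])
  have fg_ideal: "\<exists>T. finite T \<and> J = generated T" if "type_ideal J" "I \<subseteq> J" for J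
    using finitely_generated_if_primes_finitely_generated[OF fg that] .
  have carrier: "carrier ?Q = range (a_r_coset ?R I)"
    by (auto simp: FactRing_def A_RCOSETS_def')
  have vimage: "type_ideal {x. a_r_coset ?R I x \<in> K}" "I \<subseteq> {x. a_r_coset ?R I x \<in> K}"
    if K: "ideal K ?Q" for K
  proof -
    show "type_ideal {x. a_r_coset ?R I x \<in> K}"
      using h.ideal_vimage[OF K] by simp
    have "I \<in> K"
      using additive_subgroup.zero_closed[OF ideal.axioms(1)[OF K]] by (simp add: FactRing_def)
    then show "I \<subseteq> {x. a_r_coset ?R I x \<in> K}"
      using I.a_rcos_const by auto
  qed
  have "noetherian_ring ?Q"
  proof (intro noetherian_ring.intro noetherian_ring_axioms.intro I.quotient_is_ring)
    fix K assume K: "ideal K ?Q"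
    obtain T where T: "finite T" "{x. a_r_coset ?R I x \<in> K} = generated T"
      using fg_ideal vimage[OF K] by blast
    define U where "U = a_r_coset ?R I ` T"
    have U: "U \<subseteq> carrier ?Q" by (auto simp: U_def carrier)
    have "{x. a_r_coset ?R I x \<in> K} \<subseteq> {x. a_r_coset ?R I x \<in> Idl\<^bsub>?Q\<^esub> U}"
      unfolding T(2)
    proof (rule generated_minimal)
      show "type_ideal {x. a_r_coset ?R I x \<in> Idl\<^bsub>?Q\<^esub> U}"
        by (rule vimage[OF h.S.genideal_ideal[OF U]])
      show "T \<subseteq> {x. a_r_coset ?R I x \<in> Idl\<^bsub>?Q\<^esub> U}"
        using h.S.genideal_self[OF U] by (auto simp: U_def)
    qed
    moreover have "K \<subseteq> carrier ?Q"
      by (rule additive_subgroup.a_subset[OF ideal.axioms(1)[OF K]])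
    ultimately have "K \<subseteq> Idl\<^bsub>?Q\<^esub> U" unfolding carrier by blast
    moreover have "U \<subseteq> K"
      using generated_superset[of T] unfolding T(2)[symmetric] by (auto simp: U_def)
    then have "Idl\<^bsub>?Q\<^esub> U \<subseteq> K" by (rule h.S.genideal_minimal[OF K])
    ultimately show "\<exists>A\<subseteq>carrier ?Q. finite A \<and> K = Idl\<^bsub>?Q\<^esub> A"
      using U T(1) by (intro exI[of _ U]) (auto simp: U_def)
  qed
  moreover have "cohen_macaulay_local_ring (localization ?Q (carrier ?Q - N))" if N: "maximalideal N ?Q" for N
  proof -
    interpret N: maximalideal N ?Q by (rule N)
    define M where "M = {x. a_r_coset ?R I x \<in> N}"
    have M: "type_ideal M" "I \<subseteq> M"
      unfolding M_def by (rule vimage[OF N.is_ideal])+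
    have image: "N = a_r_coset ?R I ` M"
      using additive_subgroup.a_subset[OF N.is_additive_subgroup] unfolding M_def carrier by blast
    have "type_maximal M"
    proof (rule type_maximalI[OF M(1)])
      have "a_r_coset ?R I 1 = \<one>\<^bsub>?Q\<^esub>" by (simp add: FactRing_def)
      then show "1 \<notin> M"
        using ideal.one_imp_carrier[OF N.is_ideal] N.I_notcarr by (auto simp: M_def)
      fix J assume J: "type_ideal J" "M \<subset> J"
      have "I \<subseteq> J" using M J by blast
      let ?K = "a_r_coset ?R I ` J"
      have K: "ideal ?K ?Q"
        using ring.ring_ideal_imp_quot_ideal[OF ring_from_type_algebra I J(1)] .
      obtain x where "x \<in> J" "x \<notin> M" using J(2) by blast
      then have "a_r_coset ?R I x \<in> ?K" "a_r_coset ?R I x \<notin> N" by (auto simp: M_def)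
      then have "?K \<noteq> N" by blast
      moreover have "N \<subseteq> ?K" using image J(2) by blast
      moreover have "?K \<subseteq> carrier ?Q" unfolding carrier by blast
      ultimately have "?K = carrier ?Q" using N.I_maximal[OF K] by blast
      then obtain y where y: "y \<in> J" "a_r_coset ?R I 1 = a_r_coset ?R I y"
        unfolding carrier by blast
      have "1 \<in> a_r_coset ?R I 1"
        using type_idealD(1)[OF I] by (force simp: a_r_coset_def')
      then obtain i where "i \<in> I" "1 = i + y"
        unfolding y(2) by (auto simp: a_r_coset_def')
      then show "1 \<in> J" using type_idealD(2)[OF J(1), of i y] y(1) \<open>I \<subseteq> J\<close> by auto
    qed
    then obtain f where f: "f \<in> M" "\<And>a. f * a \<in> I \<Longrightarrow> a \<in> I"
      using nonzerodivisor M(2) by blast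
    interpret L: local_quotient I M
      using I type_maximalD(2)[OF \<open>type_maximal M\<close>] M(2) by (rule local_quotient.intro)
    have "cohen_macaulay_local_ring L.B"
      using fg_ideal dim f by (rule L.cohen_macaulay_local_ring_B)
    then show ?thesis unfolding L.B_def image L.denominators .
  qed
  ultimately show ?thesis
    unfolding cohen_macaulay_ideal_def cohen_macaulay_ring_def using I cring by blast
qed

section \<open>Polynomials and the coordinate axes\<close>

lemma mpoly_eq_sum_of_terms:
  "p = (\<Sum>m\<in>Poly_Mapping.keys p. Poly_Mapping.single m (Poly_Mapping.lookup p m))"
  by (rule poly_mapping_eqI)
    (auto simp: lookup_sum lookup_single when_def sum.delta in_keys_iff)

lemma mult_eq_double_sum:
  fixes p q :: "('v, 'k::field) mpoly"
  shows "p * q = (\<Sum>(m, n)\<in>Poly_Mapping.keys p \<times> Poly_Mapping.keys q.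
      Poly_Mapping.single (m + n) (Poly_Mapping.lookup p m * Poly_Mapping.lookup q n))"
proof -
  have "p * q = (\<Sum>m\<in>Poly_Mapping.keys p. Poly_Mapping.single m (Poly_Mapping.lookup p m)) *
      (\<Sum>n\<in>Poly_Mapping.keys q. Poly_Mapping.single n (Poly_Mapping.lookup q n))"
    using mpoly_eq_sum_of_terms[of p] mpoly_eq_sum_of_terms[of q] by simp
  also have "\<dots> = (\<Sum>(m, n)\<in>Poly_Mapping.keys p \<times> Poly_Mapping.keys q.
      Poly_Mapping.single (m + n) (Poly_Mapping.lookup p m * Poly_Mapping.lookup q n))"
    by (simp add: sum_product sum.cartesian_product mult_single)
  finally show ?thesis .
qed

lemma ideal_sum_mem:
  assumes "type_ideal J" "\<And>x. x \<in> A \<Longrightarrow> f x \<in> J"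
  shows "sum f A \<in> J"
  using assms(2) by (induction A rule: infinite_finite_induct) (auto simp: type_idealD[OF assms(1)])

lemma mem_ideal_if_monomials_mem:
  fixes p :: "('v, 'k::field) mpoly"
  assumes J: "type_ideal J" and "\<And>m. m \<in> Poly_Mapping.keys p \<Longrightarrow> Poly_Mapping.single m 1 \<in> J"
  shows "p \<in> J"
proof -
  have "Poly_Mapping.single m (Poly_Mapping.lookup p m) \<in> J" if "m \<in> Poly_Mapping.keys p" for m
    using type_idealD(3)[OF J assms(2)[OF that], of "Poly_Mapping.single 0 (Poly_Mapping.lookup p m)"]
    by (simp add: mult_single)
  then have "(\<Sum>m\<in>Poly_Mapping.keys p. Poly_Mapping.single m (Poly_Mapping.lookup p m)) \<in> J"
    by (rule ideal_sum_mem[OF J])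
  then show ?thesis using mpoly_eq_sum_of_terms[of p] by simp
qed

lemma mem_ideal_of_monomial_divisor:
  assumes J: "type_ideal J" and n: "Poly_Mapping.single n (1::'k::field) \<in> J"
    and le: "\<And>j. Poly_Mapping.lookup n j \<le> Poly_Mapping.lookup m j"
  shows "Poly_Mapping.single (m :: 'v \<Rightarrow>\<^sub>0 nat) 1 \<in> J"
proof -
  have "m = (m - n) + n"
    using le by (intro poly_mapping_eqI) (simp add: lookup_add lookup_minus)
  then have "Poly_Mapping.single m (1::'k) = Poly_Mapping.single (m - n) 1 * Poly_Mapping.single n 1"
    by (simp add: mult_single)
  then show ?thesis using type_idealD(3)[OF J n] by simp
qed

lemma monomial_ideal:
  fixes U :: "('v \<Rightarrow>\<^sub>0 nat) set"
  assumes "\<And>m n. m \<in> U \<Longrightarrow> n + m \<in> U"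
  shows "type_ideal {p :: ('v, 'k::field) mpoly. Poly_Mapping.keys p \<subseteq> U}"
  unfolding type_ideal_iff
proof (intro conjI ballI allI; unfold mem_Collect_eq)
  show "Poly_Mapping.keys (0 :: ('v, 'k) mpoly) \<subseteq> U" by simp
  fix p q :: "('v, 'k) mpoly" assume p: "Poly_Mapping.keys p \<subseteq> U"
  show "Poly_Mapping.keys (p + q) \<subseteq> U" if "Poly_Mapping.keys q \<subseteq> U"
    using keys_add[of p q] p that by blast
  show "Poly_Mapping.keys (q * p) \<subseteq> U"
    using keys_mult[of q p] p assms by blast
qed

definition on_axis :: "'v \<Rightarrow> ('v \<Rightarrow>\<^sub>0 nat) \<Rightarrow> bool" where
  "on_axis i m \<longleftrightarrow> (\<forall>j. j \<noteq> i \<longrightarrow> Poly_Mapping.lookup m j = 0)"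

text \<open>Restriction of a polynomial to the \<open>i\<close>-th coordinate axis, that is, the homomorphism onto \<open>K[t]\<close>
  with \<open>x\<^sub>i\<close> sent to \<open>t\<close> and all other variables to \<open>0\<close>.\<close>

definition axis :: "'v \<Rightarrow> ('v, 'k::field) mpoly \<Rightarrow> 'k poly" where
  "axis i p = (\<Sum>m\<in>Poly_Mapping.keys p.
     if on_axis i m then Polynomial.monom (Poly_Mapping.lookup p m) (Poly_Mapping.lookup m i) else 0)"

lemma on_axis_iff: "on_axis i m \<longleftrightarrow> m = Poly_Mapping.single i (Poly_Mapping.lookup m i)"
proof
  assume "on_axis i m"
  then show "m = Poly_Mapping.single i (Poly_Mapping.lookup m i)"
    by (intro poly_mapping_eqI) (auto simp: on_axis_def lookup_single when_def)
next
  assume *: "m = Poly_Mapping.single i (Poly_Mapping.lookup m i)"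
  show "on_axis i m"
    unfolding on_axis_def by (subst *) (simp add: lookup_single when_def)
qed

lemma on_axis_add: "on_axis i (m + n) \<longleftrightarrow> on_axis i m \<and> on_axis i n"
  by (auto simp: on_axis_def lookup_add)

lemma coeff_axis: "poly.coeff (axis i p) n = Poly_Mapping.lookup p (Poly_Mapping.single i n)"
proof -
  let ?t = "Poly_Mapping.single i n"
  have "poly.coeff (if on_axis i m then Polynomial.monom (Poly_Mapping.lookup p m) (Poly_Mapping.lookup m i) else 0) n
      = (if m = ?t then Poly_Mapping.lookup p ?t else 0)" for m
  proof (cases "m = ?t")
    case True
    then show ?thesis by (simp add: on_axis_def lookup_single when_def)
  next
    case False
    then have "\<not> (on_axis i m \<and> Poly_Mapping.lookup m i = n)"
      unfolding on_axis_iff by auto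
    then show ?thesis using False by auto
  qed
  then have "poly.coeff (axis i p) n = (\<Sum>m\<in>Poly_Mapping.keys p. if m = ?t then Poly_Mapping.lookup p ?t else 0)"
    by (simp add: axis_def coeff_sum)
  also have "\<dots> = Poly_Mapping.lookup p ?t"
    by (simp add: sum.delta in_keys_iff)
  finally show ?thesis .
qed

lemma axis_add: "axis i (p + q) = axis i p + axis i q"
  by (rule poly_eqI) (simp add: coeff_axis lookup_add)

lemma axis_diff: "axis i (p - q) = axis i p - axis i q"
  by (rule poly_eqI) (simp add: coeff_axis lookup_minus)

lemma axis_zero: "axis i 0 = 0"
  by (rule poly_eqI) (simp add: coeff_axis)

lemma axis_sum: "axis i (sum f A) = (\<Sum>x\<in>A. axis i (f x))"
  by (induction A rule: infinite_finite_induct) (simp_all add: axis_add axis_zero)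

lemma axis_single:
  "axis i (Poly_Mapping.single m c) = (if on_axis i m then Polynomial.monom c (Poly_Mapping.lookup m i) else 0)"
  by (cases "c = 0") (simp_all add: axis_def)

lemma axis_mult: "axis i (p * q) = axis i p * axis i q"
proof -
  have "axis i (p * q) = (\<Sum>(m, n)\<in>Poly_Mapping.keys p \<times> Poly_Mapping.keys q.
      axis i (Poly_Mapping.single m (Poly_Mapping.lookup p m)) * axis i (Poly_Mapping.single n (Poly_Mapping.lookup q n)))"
    unfolding mult_eq_double_sum[of p q] axis_sum
    by (intro sum.cong) (auto simp: axis_single on_axis_add lookup_add mult_monom)
  also have "\<dots> = axis i p * axis i q"
    by (simp add: axis_def[of i p] axis_def[of i q] axis_single sum_product sum.cartesian_product)
  finally show ?thesis .
qed

lemma axis_one: "axis i 1 = 1"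
  using axis_single[of i 0 1] by (simp add: on_axis_def monom_0 one_pCons)

lemma axis_indet: "axis i (indet j) = (if j = i then Polynomial.monom 1 1 else 0)"
  by (auto simp: indet_def axis_single on_axis_def lookup_single when_def)

lemma axis_surj: obtains p where "axis i p = r"
proof
  show "axis i (\<Sum>n\<le>Polynomial.degree r. Poly_Mapping.single (Poly_Mapping.single i n) (poly.coeff r n)) = r"
    by (simp add: axis_sum axis_single on_axis_def lookup_single when_def poly_as_sum_of_monoms)
qed

definition axis_ideal :: "'v \<Rightarrow> ('v, 'k::field) mpoly set" where
  "axis_ideal i = {p. axis i p = 0}"

text \<open>Every monomial of a polynomial that vanishes on the axis contains a variable other than the
  \<open>i\<close>-th, so the other variables generate the ideal of the axis.\<close>

lemma axis_ideal_subset: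
  fixes J :: "('v, 'k::field) mpoly set"
  assumes J: "type_ideal J" and ind: "\<And>j. j \<noteq> i \<Longrightarrow> indet j \<in> J"
  shows "axis_ideal i \<subseteq> J"
proof
  fix p :: "('v, 'k) mpoly" assume p: "p \<in> axis_ideal i"
  show "p \<in> J"
  proof (rule mem_ideal_if_monomials_mem[OF J])
    fix m assume m: "m \<in> Poly_Mapping.keys p"
    have "\<not> on_axis i m"
    proof
      assume "on_axis i m"
      then have "poly.coeff (axis i p) (Poly_Mapping.lookup m i) = Poly_Mapping.lookup p m"
        using on_axis_iff[of i m] by (simp add: coeff_axis)
      then show False using p m by (simp add: axis_ideal_def in_keys_iff)
    qed
    then obtain j where j: "j \<noteq> i" "Poly_Mapping.lookup m j \<noteq> 0" by (auto simp: on_axis_def)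
    show "Poly_Mapping.single m 1 \<in> J"
    proof (rule mem_ideal_of_monomial_divisor[OF J])
      show "Poly_Mapping.single (Poly_Mapping.single j 1) 1 \<in> J"
        using ind[OF j(1)] by (simp add: indet_def)
      show "Poly_Mapping.lookup (Poly_Mapping.single j 1) l \<le> Poly_Mapping.lookup m l" for l
        using j(2) by (auto simp: lookup_single when_def)
    qed
  qed
qed

text \<open>Ideals above the ideal of the axis are ideals of \<open>K[t]\<close>, and those are principal: an element
  \<open>g\<close> with nonzero restriction of least degree generates, by division with remainder.\<close>

lemma ideal_above_axis_ideal:
  fixes J :: "('v, 'k::field) mpoly set"
  assumes J: "type_ideal J" and sub: "axis_ideal i \<subseteq> J"
  obtains g where "J = {p. axis i g dvd axis i p}"
proof -
  have mem: "p \<in> J" if "q \<in> J" "axis i p = axis i q" for p q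
  proof -
    have "p - q \<in> J" using that(2) sub by (auto simp: axis_ideal_def axis_diff)
    then show ?thesis using type_idealD(2)[OF J _ that(1)] by fastforce
  qed
  show ?thesis
  proof (cases "\<forall>p\<in>J. axis i p = 0")
    case True
    then have "J = {p. axis i 0 dvd axis i p}"
      using sub by (auto simp: axis_zero axis_ideal_def)
    then show ?thesis by (rule that)
  next
    case False
    then obtain q where q: "q \<in> J \<and> axis i q \<noteq> 0" by blast
    obtain g where g: "g \<in> J" "axis i g \<noteq> 0"
      and min: "\<And>p. p \<in> J \<Longrightarrow> axis i p \<noteq> 0 \<Longrightarrow> Polynomial.degree (axis i g) \<le> Polynomial.degree (axis i p)"
      using ex_has_least_nat[of "\<lambda>p. p \<in> J \<and> axis i p \<noteq> 0", OF q,
          of "\<lambda>p. Polynomial.degree (axis i p)"] by auto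
    have "axis i g dvd axis i p" if p: "p \<in> J" for p
    proof -
      obtain q where q: "axis i q = axis i p div axis i g" using axis_surj .
      have r: "p - q * g \<in> J"
        using p type_idealD(3)[OF J g(1)] type_idealD(6)[OF J] by blast
      have *: "axis i (p - q * g) = axis i p mod axis i g"
        by (simp add: axis_diff axis_mult q minus_div_mult_eq_mod)
      have "axis i p mod axis i g = 0"
        using min[OF r] degree_mod_less[OF g(2), of "axis i p"] unfolding * by fastforce
      then show ?thesis by (simp add: dvd_eq_mod_eq_0)
    qed
    moreover have "p \<in> J" if dvd: "axis i g dvd axis i p" for p
    proof -
      obtain r where r: "axis i p = axis i g * r" using dvd by (rule dvdE)
      obtain q where "axis i q = r" using axis_surj .
      then have "axis i p = axis i (g * q)" using r by (simp add: axis_mult)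
      then show ?thesis using mem type_idealD(4)[OF J g(1)] by blast
    qed
    ultimately show ?thesis using that by blast
  qed
qed

lemma finitely_generated_above_axis_ideal:
  fixes J :: "('v::finite, 'k::field) mpoly set"
  assumes J: "type_ideal J" and sub: "axis_ideal i \<subseteq> J"
  shows "\<exists>T. finite T \<and> J = generated T"
proof -
  obtain g where g: "J = {p. axis i g dvd axis i p}"
    using ideal_above_axis_ideal[OF assms] .
  let ?T = "insert g (indet ` (UNIV - {i}))"
  note T = generated_ideal[of ?T] generated_superset[of ?T]
  have "generated ?T \<subseteq> J"
    by (rule generated_minimal[OF J]) (auto simp: g axis_indet)
  moreover have "J \<subseteq> generated ?T"
  proof
    fix p assume "p \<in> J"
    then have "axis i g dvd axis i p" by (simp add: g)
    then obtain r where r: "axis i p = axis i g * r" by (rule dvdE)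
    obtain q where "axis i q = r" using axis_surj .
    then have "p - q * g \<in> axis_ideal i"
      using r by (simp add: axis_ideal_def axis_diff axis_mult)
    moreover have "axis_ideal i \<subseteq> generated ?T"
      using T(2) by (intro axis_ideal_subset[OF T(1)]) auto
    ultimately have "p - q * g \<in> generated ?T" by blast
    moreover have "q * g \<in> generated ?T" using T by (intro type_idealD(3)[OF T(1)]) auto
    ultimately have "(p - q * g) + q * g \<in> generated ?T" by (rule type_idealD(2)[OF T(1)])
    then show "p \<in> generated ?T" by simp
  qed
  ultimately show ?thesis by (intro exI[of _ ?T]) auto
qed

text \<open>In \<open>K[t]\<close> a nonzero prime \<open>(g)\<close> is maximal: if \<open>(g)\<close> lies strictly inside \<open>(h)\<close>, then \<open>g = h k\<close>, and as \<open>h\<close>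
  is not in \<open>(g)\<close>, primality puts \<open>k\<close> in \<open>(g)\<close>, so that \<open>h\<close> is a unit.\<close>

lemma maximal_above_axis_ideal:
  fixes P :: "('v, 'k::field) mpoly set"
  assumes P: "type_prime P" and sub: "axis_ideal i \<subset> P"
  shows "type_maximal P"
proof (rule type_maximalI)
  show id: "type_ideal P" and "1 \<notin> P" using P by (auto simp: type_prime_iff)
  fix J assume J: "type_ideal J" "P \<subset> J"
  obtain g where g: "P = {p. axis i g dvd axis i p}"
    using ideal_above_axis_ideal[OF id] sub by blast
  obtain h where h: "J = {p. axis i h dvd axis i p}"
    using ideal_above_axis_ideal[OF J(1)] sub J(2) by blast
  have nz: "axis i g \<noteq> 0" using sub unfolding g axis_ideal_def by auto
  have "g \<in> P" by (simp add: g)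
  then have "axis i h dvd axis i g" using J(2) h by blast
  then obtain r where r: "axis i g = axis i h * r" by (rule dvdE)
  obtain k where k: "axis i k = r" using axis_surj .
  have "h * k \<in> P" by (simp add: g axis_mult k r)
  moreover have "h \<notin> P"
  proof
    assume "h \<in> P"
    then have "axis i g dvd axis i h" by (simp add: g)
    then have "J \<subseteq> P" unfolding g h by (auto intro: dvd_trans)
    then show False using J(2) by blast
  qed
  ultimately have "k \<in> P" using P by (auto simp: type_prime_iff)
  then have "axis i g dvd r" by (simp add: g k)
  then obtain l where l: "r = axis i g * l" by (rule dvdE)
  have "axis i g * 1 = axis i g * (axis i h * l)"
    using r unfolding l by (metis mult.left_commute mult_1_right)
  then have "axis i h * l = 1" using nz by (metis mult_cancel_left)
  then have "axis i h dvd 1" by (metis dvd_triv_left)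
  then show "1 \<in> J" by (simp add: h axis_one)
qed

lemma axis_ideal_not_maximal: "\<not> type_maximal (axis_ideal i :: ('v, 'k::field) mpoly set)"
proof
  let ?x = "indet i :: ('v, 'k) mpoly"
  assume max: "type_maximal (axis_ideal i :: ('v, 'k) mpoly set)"
  note id = type_maximalD(1)[OF max]
  have "?x \<notin> axis_ideal i" by (simp add: axis_ideal_def axis_indet)
  then have "adjoin (axis_ideal i) ?x \<noteq> axis_ideal i"
    using adjoin_mem[OF id] by blast
  then have "1 \<in> adjoin (axis_ideal i) ?x"
    using type_maximalD(4)[OF max adjoin_ideal[OF id] adjoin_superset] by blast
  then obtain p r where "1 = p + r * ?x" "axis i p = 0"
    unfolding adjoin_def axis_ideal_def by auto
  then have "1 = axis i r * Polynomial.monom 1 1"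
    by (metis axis_one axis_add axis_mult axis_indet add_0)
  then have "poly.coeff 1 0 = poly.coeff (axis i r * Polynomial.monom 1 1) 0" by metis
  then show False by (simp add: coeff_mult)
qed

lemma prime_containing_products_above_axis_ideal:
  fixes P :: "('v, 'k::field) mpoly set"
  assumes P: "type_prime P" and prod: "\<And>j k. j \<noteq> k \<Longrightarrow> indet j * indet k \<in> P"
  obtains i where "axis_ideal i \<subseteq> P"
proof (cases "\<exists>i. indet i \<notin> P")
  case True
  then obtain i where i: "indet i \<notin> P" by blast
  have "indet j \<in> P" if "j \<noteq> i" for j
    using prod[OF that] i P by (auto simp: type_prime_iff)
  then show ?thesis using axis_ideal_subset[of P i] P that by (auto simp: type_prime_iff)
next
  case False
  then show ?thesis using axis_ideal_subset[of P] P that by (auto simp: type_prime_iff)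
qed

text \<open>The monomials outside \<open>N\<close> span a monomial ideal whose generators do not involve \<open>x\<^sub>i\<close>, and the claim is
  that an \<open>f\<close> which does not vanish on the axis is a nonzerodivisor modulo this ideal. This is a
  leading term argument: among the monomials of \<open>a\<close> in \<open>N\<close> take one, \<open>m0\<close>, whose total degree in the
  variables other than \<open>x\<^sub>i\<close> is least and whose exponent of \<open>x\<^sub>i\<close> is then greatest; for \<open>f\<close> take the greatest
  power \<open>n0\<close> of \<open>x\<^sub>i\<close> that occurs. The product \<open>n0 + m0\<close> arises in no other way, so its coefficient in
  \<open>f * a\<close> does not cancel.\<close>

lemma mult_has_monomial_in_axis_invariant_set:
  fixes f a :: "('v::finite, 'k::field) mpoly"
  assumes down: "\<And>m n. n + m \<in> N \<Longrightarrow> m \<in> N"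
    and inv: "\<And>m n. m \<in> N \<Longrightarrow> on_axis i n \<Longrightarrow> n + m \<in> N"
    and f: "f \<notin> axis_ideal i" and a: "Poly_Mapping.keys a \<inter> N \<noteq> {}"
  shows "Poly_Mapping.keys (f * a) \<inter> N \<noteq> {}"
proof -
  define off where "off m = (\<Sum>j\<in>UNIV - {i}. Poly_Mapping.lookup m j)" for m :: "'v \<Rightarrow>\<^sub>0 nat"
  have off_add: "off (m + n) = off m + off n" for m n
    by (simp add: off_def lookup_add sum.distrib)
  have off_0: "off m = 0 \<longleftrightarrow> on_axis i m" for m
    by (auto simp: off_def on_axis_def)
  define K where "K = Poly_Mapping.keys a \<inter> N"
  define D where "D = Min (off ` K)"
  have K: "finite K" "K \<noteq> {}" using a by (auto simp: K_def)
  have D: "D \<le> off m" if "m \<in> K" for m using K that by (simp add: D_def)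
  have "D \<in> off ` K" using K by (auto simp: D_def intro: Min_in)
  define L where "L = {m \<in> K. off m = D}"
  have L: "finite L" "L \<noteq> {}" using K \<open>D \<in> off ` K\<close> by (auto simp: L_def)
  define e where "e = Max ((\<lambda>m. Poly_Mapping.lookup m i) ` L)"
  have e: "Poly_Mapping.lookup m i \<le> e" if "m \<in> L" for m using L that by (simp add: e_def)
  have "e \<in> (\<lambda>m. Poly_Mapping.lookup m i) ` L" using L by (auto simp: e_def intro: Max_in)
  then obtain m0 where m0: "m0 \<in> L" "Poly_Mapping.lookup m0 i = e" by blast
  define b where "b = Polynomial.degree (axis i f)"
  define n0 where "n0 = Poly_Mapping.single i b"
  have "poly.coeff (axis i f) b \<noteq> 0" using f by (simp add: axis_ideal_def b_def)
  then have n0: "n0 \<in> Poly_Mapping.keys f" by (simp add: coeff_axis n0_def in_keys_iff)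
  have m0K: "m0 \<in> K" "off m0 = D" "m0 \<in> Poly_Mapping.keys a" "m0 \<in> N"
    using m0 by (auto simp: L_def K_def)
  have axis_n0: "on_axis i n0" by (auto simp: n0_def on_axis_def lookup_single when_def)
  have tN: "n0 + m0 \<in> N" by (rule inv[OF m0K(4) axis_n0])
  have unique: "n = n0 \<and> m = m0"
    if nm: "n \<in> Poly_Mapping.keys f" "m \<in> Poly_Mapping.keys a" "n + m = n0 + m0" for n m
  proof -
    have "m \<in> N" using nm(3) tN down by metis
    then have mK: "m \<in> K" using nm by (simp add: K_def)
    have "off n + off m = D"
      using arg_cong[OF nm(3), of off] off_0 axis_n0 m0K(2) by (simp add: off_add)
    then have "off m = D" "off n = 0" using D[OF mK] by auto
    then have "m \<in> L" and axis_n: "on_axis i n" using mK off_0 by (auto simp: L_def)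
    have "poly.coeff (axis i f) (Poly_Mapping.lookup n i) \<noteq> 0"
      using nm(1) axis_n on_axis_iff[of i n] by (simp add: coeff_axis in_keys_iff)
    then have "Poly_Mapping.lookup n i \<le> b" unfolding b_def by (rule le_degree)
    moreover have "Poly_Mapping.lookup n i + Poly_Mapping.lookup m i = b + e"
      using arg_cong[OF nm(3), of "\<lambda>x. Poly_Mapping.lookup x i"] m0 by (simp add: lookup_add n0_def)
    ultimately have "Poly_Mapping.lookup n i = b" using e[OF \<open>m \<in> L\<close>] by linarith
    then have "n = n0" using axis_n unfolding on_axis_iff n0_def by simp
    then show ?thesis using nm(3) by simp
  qed
  have "Poly_Mapping.lookup (f * a) (n0 + m0) = (\<Sum>p\<in>Poly_Mapping.keys f \<times> Poly_Mapping.keys a.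
      if p = (n0, m0) then Poly_Mapping.lookup f n0 * Poly_Mapping.lookup a m0 else 0)"
    unfolding mult_eq_double_sum[of f a] lookup_sum
    by (intro sum.cong) (auto simp: lookup_single when_def dest: unique split: if_splits)
  also have "\<dots> = Poly_Mapping.lookup f n0 * Poly_Mapping.lookup a m0"
    using n0 m0K(3) by (simp add: sum.delta)
  also have "\<dots> \<noteq> 0" using n0 m0K(3) by (simp add: in_keys_iff)
  finally show ?thesis using tN by (auto simp: in_keys_iff)
qed

lemma mem_all_but_axis_ideals:
  fixes M :: "('v::finite, 'k::field) mpoly set"
  assumes M: "type_maximal M" "axis_ideal i \<subseteq> M"
  obtains f where "f \<in> M" "\<And>j. f \<notin> axis_ideal j"
proof -
  note id = type_maximalD(1)[OF M(1)]
  have "axis_ideal i \<noteq> M" using axis_ideal_not_maximal M(1) by metis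
  then obtain g where g: "g \<in> M" "g \<notin> axis_ideal i" using M(2) by blast
  \<comment> \<open>On the \<open>i\<close>-th axis only the first summand survives, on any other one a single variable.\<close>
  define f :: "('v, 'k) mpoly" where "f = g * indet i + (\<Sum>j\<in>UNIV - {i}. indet j)"
  have "indet j \<in> M" if "j \<noteq> i" for j
    using M(2) that by (auto simp: axis_ideal_def axis_indet)
  then have "f \<in> M"
    unfolding f_def by (intro type_idealD(2)[OF id] type_idealD(4)[OF id g(1)] ideal_sum_mem[OF id]) auto
  moreover have "f \<notin> axis_ideal j" for j
  proof -
    have "axis j f = axis j g * axis j (indet i) + (\<Sum>k\<in>UNIV - {i}. if k = j then Polynomial.monom 1 1 else 0)"
      by (simp add: f_def axis_add axis_mult axis_sum axis_indet cong: if_cong)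
    then show ?thesis
      using g(2) by (cases "j = i") (auto simp: axis_ideal_def axis_indet sum.delta)
  qed
  ultimately show ?thesis by (rule that)
qed

section \<open>The edge ideal of an acyclic tournament\<close>

lemma complete_graph_arrow:
  assumes "complete_graph (underlying_edges E)" "x \<noteq> y"
  shows "(x, y) \<in> E \<or> (y, x) \<in> E"
proof -
  have "{x, y} \<in> underlying_edges E"
    using assms unfolding complete_graph_def by blast
  then show ?thesis by (auto simp: underlying_edges_def doubleton_eq_iff)
qed

text \<open>A failure of transitivity closes an oriented triangle.\<close>

lemma acyclic_tournament_trans:
  assumes "oriented_graph E" "complete_graph (underlying_edges E)" "\<nexists>c. oriented_cycle E c"
  shows "trans E"
proof (rule transI)
  fix x y z assume xy: "(x, y) \<in> E" and yz: "(y, z) \<in> E"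
  have asym: "(b, a) \<notin> E" if "(a, b) \<in> E" for a b
    using assms(1) that by (auto simp: oriented_graph_def dest: asymD)
  show "(x, z) \<in> E"
  proof (rule ccontr)
    assume xz: "(x, z) \<notin> E"
    have "x \<noteq> y" "y \<noteq> z" "x \<noteq> z" using asym xy yz by metis+
    moreover from this have "(z, x) \<in> E"
      using complete_graph_arrow[OF assms(2)] xz by blast
    ultimately have "oriented_cycle E [x, y, z]"
      using xy yz by (auto simp: oriented_cycle_def less_Suc_eq)
    then show False using assms(3) by blast
  qed
qed

definition edge_monomials :: "('v \<times> 'v) set \<Rightarrow> ('v \<Rightarrow> nat) \<Rightarrow> ('v \<Rightarrow>\<^sub>0 nat) set" where
  "edge_monomials E d = {m. \<exists>(x, y)\<in>E. 1 \<le> Poly_Mapping.lookup m x \<and> d y \<le> Poly_Mapping.lookup m y}"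

lemma indet_power: "indet x ^ n = Poly_Mapping.single (Poly_Mapping.single x n) 1"
  by (induction n) (simp_all add: indet_def mult_single flip: single_add)

lemma edge_ideal_eq_monomial_ideal:
  fixes E :: "('v::finite \<times> 'v) set"
  assumes "oriented_graph E"
  shows "(edge_ideal E d :: ('v, 'k::field) mpoly set) = {p. Poly_Mapping.keys p \<subseteq> edge_monomials E d}"
    (is "_ = ?J")
proof
  let ?G = "{indet x * indet y ^ d y | x y. (x, y) \<in> E} :: ('v, 'k) mpoly set"
  have gen: "indet x * indet y ^ n =
      (Poly_Mapping.single (Poly_Mapping.single x 1 + Poly_Mapping.single y n) 1 :: ('v, 'k) mpoly)" for x y n
    by (simp add: indet_power) (simp add: indet_def mult_single)
  have neq: "x \<noteq> y" if "(x, y) \<in> E" for x y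
    using assms that by (auto simp: oriented_graph_def dest: asymD)
  show "edge_ideal E d \<subseteq> ?J"
    unfolding edge_ideal_def polynomial_ring_def
  proof (rule generated_minimal)
    show "type_ideal ?J"
      by (rule monomial_ideal) (force simp: edge_monomials_def lookup_add)
    have "Poly_Mapping.single x 1 + Poly_Mapping.single y (d y) \<in> edge_monomials E d"
      if "(x, y) \<in> E" for x y
      unfolding edge_monomials_def using that
      by (intro CollectI bexI[of _ "(x, y)"]) (auto simp: lookup_add lookup_single)
    then show "?G \<subseteq> ?J" by (auto simp: gen)
  qed
  show "?J \<subseteq> edge_ideal E d"
    unfolding edge_ideal_def polynomial_ring_def
  proof
    note G = generated_ideal[of ?G] generated_superset[of ?G]
    fix p assume p: "p \<in> ?J"
    show "p \<in> generated ?G"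
    proof (rule mem_ideal_if_monomials_mem[OF G(1)])
      fix m assume "m \<in> Poly_Mapping.keys p"
      then have "m \<in> edge_monomials E d" using p by blast
      then obtain x y where xy: "(x, y) \<in> E" "1 \<le> Poly_Mapping.lookup m x" "d y \<le> Poly_Mapping.lookup m y"
        unfolding edge_monomials_def by blast
      show "Poly_Mapping.single m 1 \<in> generated ?G"
      proof (rule mem_ideal_of_monomial_divisor[OF G(1)])
        have "indet x * indet y ^ d y \<in> ?G" using xy(1) by blast
        then show "Poly_Mapping.single (Poly_Mapping.single x 1 + Poly_Mapping.single y (d y)) 1 \<in> generated ?G"
          using G(2) unfolding gen by blast
        show "Poly_Mapping.lookup (Poly_Mapping.single x 1 + Poly_Mapping.single y (d y)) j
            \<le> Poly_Mapping.lookup m j" for j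
          using xy neq[OF xy(1)] by (auto simp: lookup_add lookup_single when_def)
      qed
    qed
  qed
qed

text \<open>The prime contains one of every two variables, because two distinct vertices are joined by an
  arrow and the corresponding generator is a product of powers of the two variables.\<close>

lemma prime_above_edge_ideal:
  fixes P :: "('v::finite, 'k::field) mpoly set"
  assumes complete: "complete_graph (underlying_edges E)"
    and P: "type_prime P" and sub: "edge_ideal E d \<subseteq> P"
  obtains i where "axis_ideal i \<subseteq> P"
proof (rule prime_containing_products_above_axis_ideal[OF P])
  have id: "type_ideal P" and one: "1 \<notin> P" and prime: "a * b \<in> P \<Longrightarrow> a \<in> P \<or> b \<in> P" for a b
    using P by (auto simp: type_prime_iff)
  have power: "a ^ n \<in> P \<Longrightarrow> a \<in> P" for a n
    by (induction n) (auto simp: one dest: prime)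
  have arrow: "indet x \<in> P \<or> indet y \<in> P" if xy: "(x, y) \<in> E" for x y
  proof -
    have "indet x * indet y ^ d y \<in> generated {indet x * indet y ^ d y | x y. (x, y) \<in> E}"
      using xy by (intro subsetD[OF generated_superset]) blast
    then have "indet x * indet y ^ d y \<in> P"
      using sub by (auto simp: edge_ideal_def polynomial_ring_def)
    then show ?thesis using prime power by blast
  qed
  fix j k :: 'v assume "j \<noteq> k"
  then have "indet j \<in> P \<or> indet k \<in> P"
    using complete_graph_arrow[OF complete] arrow by blast
  then show "indet j * indet k \<in> P" using type_idealD(3,4)[OF id] by blast
qed (rule that)

text \<open>The set \<open>N i\<close> consists of the monomials outside the primary component of the edge ideal at the
  \<open>i\<close>-th axis. A monomial outside the edge ideal lies in \<open>N i\<close> for the first vertex \<open>i\<close> of its support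
  (for every \<open>i\<close> if it is \<open>1\<close>), and no monomial of \<open>N i\<close> is in the edge ideal: an arrow \<open>(x, y)\<close>
  witnessing that would start at \<open>i\<close> or after \<open>i\<close>, and so \<open>y\<close> would come after \<open>i\<close>. Hence products with \<open>f\<close> stay outside the edge ideal.\<close>

lemma edge_ideal_nonzerodivisor:
  fixes f a :: "('v::finite, 'k::field) mpoly"
  assumes D: "weighted_oriented_graph E d" and complete: "complete_graph (underlying_edges E)"
    and acyclic: "\<nexists>c. oriented_cycle E c"
    and f: "\<And>i. f \<notin> axis_ideal i" and fa: "f * a \<in> edge_ideal E d"
  shows "a \<in> edge_ideal E d"
proof (rule ccontr)
  have graph: "oriented_graph E" and d: "1 \<le> d x" for x
    using D by (auto simp: weighted_oriented_graph_def)
  have asym: "(y, x) \<notin> E" if "(x, y) \<in> E" for x y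
    using graph that by (auto simp: oriented_graph_def dest: asymD)
  have trans: "trans E" by (rule acyclic_tournament_trans[OF graph complete acyclic])
  note ideal_eq = edge_ideal_eq_monomial_ideal[OF graph, of d]
  assume "a \<notin> edge_ideal E d"
  then obtain m where m: "m \<in> Poly_Mapping.keys a" "m \<notin> edge_monomials E d"
    unfolding ideal_eq by blast
  define N where "N i = {m. \<forall>j. ((j, i) \<in> E \<longrightarrow> Poly_Mapping.lookup m j = 0) \<and>
      ((i, j) \<in> E \<longrightarrow> Poly_Mapping.lookup m j < d j)}" for i
  have "\<exists>i. m \<in> N i"
  proof (cases "m = 0")
    case True
    then show ?thesis using d by (auto simp: N_def Suc_le_eq)
  next
    case False
    let ?S = "{j. Poly_Mapping.lookup m j \<noteq> 0}"
    have "?S \<noteq> {}" using False by (auto intro: poly_mapping_eqI)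
    moreover have "wf E"
      using trans asym by (intro finite_acyclic_wf acyclicI) (auto simp: trancl_id)
    ultimately obtain i where "i \<in> ?S" "\<And>j. (j, i) \<in> E \<Longrightarrow> j \<notin> ?S"
      using wfE_min'[of E ?S] by metis
    then have i: "Poly_Mapping.lookup m i \<noteq> 0"
      and min: "\<And>j. (j, i) \<in> E \<Longrightarrow> Poly_Mapping.lookup m j = 0"
      by auto
    have "Poly_Mapping.lookup m j < d j" if "(i, j) \<in> E" for j
      using m(2) that i by (force simp: edge_monomials_def)
    then show ?thesis using min by (auto simp: N_def)
  qed
  then obtain i where i: "m \<in> N i" by blast
  have "Poly_Mapping.keys (f * a) \<inter> N i \<noteq> {}"
  proof (rule mult_has_monomial_in_axis_invariant_set[OF _ _ f])
    show "m' \<in> N i" if "n + m' \<in> N i" for m' n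
      using that by (fastforce simp: N_def lookup_add)
    show "n + m' \<in> N i" if m': "m' \<in> N i" and n: "on_axis i n" for m' n
    proof -
      have "Poly_Mapping.lookup n j = 0" if "(j, i) \<in> E \<or> (i, j) \<in> E" for j
        using that n asym unfolding on_axis_def by metis
      then show ?thesis using m' by (simp add: N_def lookup_add)
    qed
    show "Poly_Mapping.keys a \<inter> N i \<noteq> {}" using m(1) i by blast
  qed
  then obtain m' where m': "m' \<in> N i" "m' \<in> edge_monomials E d"
    using fa unfolding ideal_eq by blast
  then obtain x y where xy: "(x, y) \<in> E" "1 \<le> Poly_Mapping.lookup m' x" "d y \<le> Poly_Mapping.lookup m' y"
    unfolding edge_monomials_def by blast
  have "(x, i) \<notin> E" "(i, y) \<notin> E" using m'(1) xy(2,3) by (auto simp: N_def leD)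
  moreover have "x \<noteq> i" using xy(1) calculation(2) by blast
  ultimately have "(i, x) \<in> E" using complete_graph_arrow[OF complete] by blast
  then have "(i, y) \<in> E" by (rule transD[OF trans _ xy(1)])
  then show False using \<open>(i, y) \<notin> E\<close> by blast
qed

theorem corollary7:
  fixes E :: "('v::finite \<times> 'v) set" and d :: "'v \<Rightarrow> nat"
  assumes "weighted_oriented_graph E d"
    and "complete_graph (underlying_edges E)"
    and "\<not> (\<exists>c. oriented_cycle E c)"
  shows "cohen_macaulay_ideal (edge_ideal E d)
           (polynomial_ring :: ('v, 'k::field) mpoly ring)"
  unfolding polynomial_ring_def
proof (rule cohen_macaulay_ideal_of_dimension_one)
  let ?I = "edge_ideal E d :: ('v, 'k) mpoly set"
  note above = prime_above_edge_ideal[OF assms(2)]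
  show "type_ideal ?I"
    unfolding edge_ideal_def polynomial_ring_def by (rule generated_ideal)
  show "\<exists>T. finite T \<and> P = generated T" if "type_prime P" "?I \<subseteq> P" for P
    using above[OF that] finitely_generated_above_axis_ideal that(1) by (metis type_prime_iff)
  show False if P: "type_prime P" "type_prime P'" "type_prime P''" "?I \<subseteq> P" "P \<subset> P'" "P' \<subset> P''" for P P' P''
  proof -
    obtain i where "axis_ideal i \<subseteq> P" using above[OF P(1,4)] .
    then have "type_maximal P'" using maximal_above_axis_ideal[OF P(2)] P(5) by blast
    then show False using type_maximalD(4)[of P' P''] P(3,6) by (auto simp: type_prime_iff)
  qed
  show "\<exists>f\<in>M. \<forall>a. f * a \<in> ?I \<longrightarrow> a \<in> ?I" if M: "type_maximal M" "?I \<subseteq> M" for M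
  proof -
    obtain i where "axis_ideal i \<subseteq> M" using above[OF type_maximalD(2)[OF M(1)] M(2)] .
    then obtain f where "f \<in> M" "\<And>j. f \<notin> axis_ideal j"
      using mem_all_but_axis_ideals[OF M(1)] by blast
    then show ?thesis using edge_ideal_nonzerodivisor[OF assms] by blast
  qed
qed

end
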